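(* Let $E^\infty$ be the smallest subfield of $\mathbb{C}_\infty$ containing $\mathbb{F}_q^{\mathrm{alg}}$ and all the values $\exp(\widetilde{\pi}\rho)$, $\rho\in K$. Then $E^\infty$ is also generated over $\mathbb{F}_q^{\mathrm{alg}}$ by the values $(\mathcal{D}_n\omega)(\zeta)$, for all $\zeta\in\mathbb{F}_q^{\mathrm{alg}}$ and all integers $n\geq 0$; that is, $$E^\infty=\mathbb{F}_q^{\mathrm{alg}}\big((\mathcal{D}_n\omega)(\zeta):\ \zeta\in\mathbb{F}_q^{\mathrm{alg}},\ n\geq 0\big).$$
   Context: Let $q$ be a power of a prime $p$, $\mathbb{F}_q$ the field with $q$ elements, $A=\mathbb{F}_q[\theta]$, $K=\mathbb{F}_q(\theta)$, $v_\infty$ the $\theta^{-1}$-adic valuation with $v_\infty(\theta)=-1$, $K_\infty=\mathbb{F}_q((\theta^{-1}))$ the completion of $K$, and $\mathbb{C}_\infty$ the completion of an algebraic closure of $K_\infty$, with absolute value $|\cdot|$ normalized by $|\theta|=q$. $K^{\mathrm{alg}}$ and $\mathbb{F}_q^{\mathrm{alg}}$ denote the algebraic closures of $K$ and $\mathbb{F}_q$ in $\mathbb{C}_\infty$. Carlitz's exponential is the entire function $\exp(z)=\sum_{n\ge 0}z^{q^n}/d_n$, where $d_0=1$ and $d_n=\prod_{i=0}^{n-1}(\theta^{q^n}-\theta^{q^i})$ for $n\geq 1$. Fix a $(q-1)$-th root $(-\theta)^{1/(q-1)}\in\mathbb{C}_\infty$ of $-\theta$. Set $\widetilde{\pi}=\theta(-\theta)^{1/(q-1)}\prod_{i\ge1}(1-\theta^{1-q^i})^{-1}$,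 so that the kernel of $\exp$ is $\widetilde{\pi}A$. The Anderson-Thakur function is $$\omega(t)=(-\theta)^{1/(q-1)}\prod_{i\ge 0}\left(1-\frac{t}{\theta^{q^i}}\right)^{-1},$$ which converges for $t\in\mathbb{C}_\infty$, $|t|\le1$ (with the same choice of root). For $n\ge0$, $\mathcal{D}_n$ is the $n$-th divided derivative, i.e. the $\mathbb{C}_\infty$-linear map $\mathcal{D}_n:\mathbb{C}_\infty[[t]]\to\mathbb{C}_\infty[[t]]$ applied termwise with $\mathcal{D}_n t^m=\binom{m}{n}t^{m-n}$ (zero if $m<n$). The series $\mathcal{D}_n\omega$ converges for all $|t|\leq 1$. *)

theory Defs
  imports
    "HOL-Analysis.Analysis"
    "HOL-Computational_Algebra.Computational_Algebra"
    "HOL-Algebra.Algebraic_Closure_Type"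
begin

definition is_subfield :: "'c::field set \<Rightarrow> bool" where
  "is_subfield F \<longleftrightarrow> 0 \<in> F \<and> 1 \<in> F \<and>
     (\<forall>x\<in>F. \<forall>y\<in>F. x + y \<in> F \<and> x * y \<in> F) \<and>
     (\<forall>x\<in>F. - x \<in> F \<and> inverse x \<in> F)"

definition algebraic_over :: "'c::field set \<Rightarrow> 'c \<Rightarrow> bool" where
  "algebraic_over F x \<longleftrightarrow> (\<exists>p::'c poly. p \<noteq> 0 \<and> (\<forall>i. Polynomial.coeff p i \<in> F) \<and> poly p x = 0)"

text \<open>
  Fix a finite field \<^typ>\<open>'a\<close> with \<open>q = CARD('a)\<close> elements. The Laurent series field
  \<^typ>\<open>'a fls\<close> in the variable \<open>X = 1/\<theta>\<close> is the completion of the rational function field at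
  infinity, so \<open>\<theta>\<close> is \<^const>\<open>fls_X_inv\<close>, the valuation at infinity is
  \<^const>\<open>fls_subdegree\<close>, and \<^typ>\<open>'a fls alg_closure\<close> is an algebraic closure of it.
  The predicate below says that \<^typ>\<open>'c\<close>, with embedding \<open>\<iota>\<close>, is a completion of that algebraic
  closure for the absolute value with \<open>\<bar>\<theta>\<bar> = q\<close>. The absolute value of \<open>x\<close> is \<open>dist x 0\<close>;
  completeness is part of the sort of \<^typ>\<open>'c\<close>. (The metric that the library puts on
  \<^typ>\<open>'a fls\<close> itself plays no role.)
\<close>

definition carlitz_completion ::
    "('a::{field,finite} fls alg_closure \<Rightarrow> 'c::{field,complete_space}) \<Rightarrow> bool" where
  "carlitz_completion \<iota> \<longleftrightarrow>
     \<iota> 1 = 1 \<and>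
     (\<forall>u v. \<iota> (u + v) = \<iota> u + \<iota> v) \<and>
     (\<forall>u v. \<iota> (u * v) = \<iota> u * \<iota> v) \<and>
     (\<forall>x y::'c. dist x y = dist (x - y) 0) \<and>
     (\<forall>x y::'c. dist (x * y) 0 = dist x 0 * dist y 0) \<and>
     (\<forall>x y::'c. dist (x + y) 0 \<le> max (dist x 0) (dist y 0)) \<and>
     (\<forall>f::'a fls. f \<noteq> 0 \<longrightarrow>
        dist (\<iota> (to_ac f)) 0 = real CARD('a) powi (- fls_subdegree f)) \<and>
     closure (range \<iota>) = UNIV"

definition theta :: "('a::{field,finite} fls alg_closure \<Rightarrow> 'c::field) \<Rightarrow> 'c" where
  "theta \<iota> = \<iota> (to_ac fls_X_inv)"

definition const_field :: "('a::{field,finite} fls alg_closure \<Rightarrow> 'c::field) \<Rightarrow> 'c set" where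
  "const_field \<iota> = range (\<lambda>c. \<iota> (to_ac (fls_const c)))"

definition const_field_alg :: "('a::{field,finite} fls alg_closure \<Rightarrow> 'c::field) \<Rightarrow> 'c set" where
  "const_field_alg \<iota> = {x. algebraic_over (const_field \<iota>) x}"

definition rational_functions :: "('a::{field,finite} fls alg_closure \<Rightarrow> 'c::field) \<Rightarrow> 'c set" where
  "rational_functions \<iota> = is_subfield hull (insert (theta \<iota>) (const_field \<iota>))"

definition carlitz_d :: "nat \<Rightarrow> 'c::field \<Rightarrow> nat \<Rightarrow> 'c" where
  "carlitz_d q \<theta> n = (\<Prod>i<n. \<theta> ^ (q ^ n) - \<theta> ^ (q ^ i))"

definition carlitz_exp :: "nat \<Rightarrow> 'c::{field,metric_space} \<Rightarrow> 'c \<Rightarrow> 'c" where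
  "carlitz_exp q \<theta> z = (\<Sum>n. z ^ (q ^ n) / carlitz_d q \<theta> n)"

text \<open>In the following, \<open>r\<close> is the chosen \<open>(q-1)\<close>-th root of \<open>-\<theta>\<close>.\<close>

definition carlitz_pi :: "nat \<Rightarrow> 'c::{field,metric_space} \<Rightarrow> 'c \<Rightarrow> 'c" where
  "carlitz_pi q \<theta> r =
     \<theta> * r * prodinf (\<lambda>i. inverse (1 - \<theta> powi (1 - int (q ^ Suc i))))"

definition anderson_thakur :: "nat \<Rightarrow> 'c::{field,metric_space} \<Rightarrow> 'c \<Rightarrow> 'c \<Rightarrow> 'c" where
  "anderson_thakur q \<theta> r t = r * prodinf (\<lambda>i. inverse (1 - t / \<theta> ^ (q ^ i)))"

definition fps_value :: "'c::{field,metric_space} fps \<Rightarrow> 'c \<Rightarrow> 'c" where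
  "fps_value W t = (\<Sum>m. fps_nth W m * t ^ m)"

text \<open>
  The power series expansion of the Anderson--Thakur function, that is, the unique power series
  converging to it on the closed unit disc. (The infinite product does not converge for the
  \<open>t\<close>-adic topology that the library puts on \<^typ>\<open>'c fps\<close>.)
\<close>

definition anderson_thakur_fps :: "nat \<Rightarrow> 'c::{field,metric_space} \<Rightarrow> 'c \<Rightarrow> 'c fps" where
  "anderson_thakur_fps q \<theta> r =
     (THE W. \<forall>t. dist t 0 \<le> 1 \<longrightarrow>
        (\<lambda>m. fps_nth W m * t ^ m) sums anderson_thakur q \<theta> r t)"

definition divided_deriv :: "nat \<Rightarrow> 'c::field fps \<Rightarrow> 'c fps" where
  "divided_deriv n W = Abs_fps (\<lambda>k. of_nat ((k + n) choose n) * fps_nth W (k + n))"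

end

theory Submission
  imports Defs "HOL-Number_Theory.Cong"
begin

text \<open>
  Write \<open>e i = exp (\<pi> / \<theta> ^ (i + 1))\<close>. The bridge between the two fields is the expansion
  \<open>\<omega>(t) = (\<Sum>i. e i * t ^ i)\<close>, which turns the value of the \<open>n\<close>-th divided derivative at \<open>\<zeta>\<close> into the
  series \<open>(\<Sum>i. (i choose n) * \<zeta> ^ (i - n) * e i)\<close>. At \<open>\<zeta> = 0\<close> it is \<open>e n\<close>. For
  \<open>\<zeta> \<noteq> 0\<close> algebraic over the finite field the coefficients are periodic, because \<open>\<zeta>\<close> is a root of unity
  and \<open>i \<mapsto> (i choose n)\<close> has period \<open>p ^ s\<close> in characteristic \<open>p\<close> when \<open>n < p ^ s\<close>. On the other hand \<open>exp\<close> is additive and continuous, so summing \<open>e\<close>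
  along a residue class modulo \<open>M\<close> sums a geometric series and gives
  \<open>exp (\<pi> / (\<theta> ^ (j + 1) * (1 - \<theta> ^ (- M))))\<close>, the value at \<open>\<pi>\<close> times a rational function. Hence the
  values of the divided derivatives lie in the field of exponential values
  (\<open>periodic_tower_sums\<close>, \<open>at_value_in_subfield\<close>).

  Conversely, if \<open>M = m * p ^ s\<close> with \<open>m\<close> prime to \<open>p\<close>, then the indicator function of a residue class
  modulo \<open>M\<close> is a combination of the functions \<open>i \<mapsto> (i choose n) * \<zeta> ^ i\<close> with \<open>n < p ^ s\<close> and \<open>\<zeta> ^ m = 1\<close>:
  a character sum over the \<open>m\<close>-th roots of unity detects the class modulo \<open>m\<close>, and a single binomial
  coefficient detects the class modulo \<open>p ^ s\<close> (\<open>residue_indicator\<close>). So the values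
  \<open>exp (\<pi> / (\<theta> ^ (j + 1) * (1 - \<theta> ^ (- M))))\<close> are combinations of values of divided derivatives. These
  values suffice, because \<open>exp\<close> is linear over the finite field, kills \<open>\<pi>\<close> times any polynomial, and every
  polynomial over a finite field divides some \<open>\<theta> ^ n * (\<theta> ^ M - 1)\<close> (\<open>exp_rational_in\<close>).

  The expansion of \<open>\<omega>\<close> is proved by constructing its coefficients as a tower of division points \<open>w\<close>
  of the Carlitz module, with \<open>w 0 = r\<close> and \<open>\<theta> * w (i + 1) + w (i + 1) ^ q = w i\<close>. Raising the coefficients
  of \<open>f(t) = (\<Sum>i. w i * t ^ i)\<close> to the \<open>q\<close>-th power multiplies the series by \<open>t - \<theta>\<close>; iterating this
  gives the product formula for \<open>f\<close>, and the same computation at the pole \<open>t = \<theta>\<close> shows that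
  \<open>\<theta> ^ (n + 1) * w n\<close> tends to \<open>\<pi>\<close> (\<open>twist_has_prod\<close>, \<open>tower_tendsto_pi\<close>). The sequence \<open>e\<close> has the same
  recursion and the same asymptotics, which forces \<open>e = w\<close> (\<open>carlitz_exp_pi_div\<close>).
\<close>

section \<open>Limits and series in a complete ultrametric field\<close>

text \<open>
  The sort of \<open>'c\<close> does not relate the metric to the field operations, so the continuity of these
  operations and the rules for sums of series are derived here from the three properties of \<open>N\<close>.
\<close>

locale ultrametric_field =
  fixes N :: "'c::{field,complete_space} \<Rightarrow> real"
  assumes dist_N: "dist x y = N (x - y)"
    and N_mult: "N (x * y) = N x * N y"
    and N_add: "N (x + y) \<le> max (N x) (N y)"
begin

lemma N_eq_dist: "N x = dist x 0"
  by (simp add: dist_N)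

lemma N_nonneg [simp]: "0 \<le> N x"
  by (simp add: N_eq_dist)

lemma N_eq_0_iff [simp]: "N x = 0 \<longleftrightarrow> x = 0"
  by (simp add: N_eq_dist)

lemma N_0 [simp]: "N 0 = 0"
  by simp

lemma N_pos_iff [simp]: "0 < N x \<longleftrightarrow> x \<noteq> 0"
  by (simp add: N_eq_dist)

lemma N_1 [simp]: "N 1 = 1"
  using N_mult[of 1 1] by simp

lemma N_power: "N (x ^ n) = N x ^ n"
  by (induction n) (simp_all add: N_mult)

lemma N_inverse: "N (inverse x) = inverse (N x)"
proof (cases "x = 0")
  case False
  then have "N (inverse x) * N x = 1"
    by (simp flip: N_mult)
  then show ?thesis
    using False by (simp add: field_simps)
qed simp

lemma N_divide: "N (x / y) = N x / N y"
  by (simp add: divide_inverse N_mult N_inverse)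

lemma N_minus [simp]: "N (- x) = N x"
proof -
  have "N (-1) ^ 2 = 1"
    by (simp flip: N_power)
  then have "N (-1) = 1"
    using power2_eq_1_iff[of "N (-1)"] N_nonneg[of "-1"] by linarith
  then show ?thesis
    using N_mult[of "-1" x] by simp
qed

lemma N_diff: "N (x - y) \<le> max (N x) (N y)"
  using N_add[of x "- y"] by simp

lemma N_diff_commute: "N (x - y) = N (y - x)"
  using N_minus[of "x - y"] by simp

lemma N_triangle: "N (x + y) \<le> N x + N y"
  by (rule order_trans[OF N_add]) simp

lemma N_add_dominant:
  assumes "N y < N x"
  shows "N (x + y) = N x"
proof -
  have "N x \<le> max (N (x + y)) (N y)"
    using N_diff[of "x + y" y] by simp
  moreover have "N (x + y) \<le> N x"
    using N_add[of x y] assms by simp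
  ultimately show ?thesis
    using assms by linarith
qed

lemma N_sum_le:
  assumes "\<And>i. i \<in> A \<Longrightarrow> N (f i) \<le> B" and "0 \<le> B"
  shows "N (sum f A) \<le> B"
  using assms
proof (induction A rule: infinite_finite_induct)
  case (insert x F)
  then show ?case
    using N_add[of "f x" "sum f F"] by force
qed simp_all

lemma N_of_nat_le_1: "N (of_nat n) \<le> 1"
proof (induction n)
  case (Suc n)
  then show ?case
    using N_add[of 1 "of_nat n"] by simp
qed simp

lemma tendsto_iff_N: "u \<longlonglongrightarrow> L \<longleftrightarrow> (\<lambda>n. N (u n - L)) \<longlonglongrightarrow> 0"
  by (subst tendsto_dist_iff) (simp add: dist_N)

lemma tendsto_N_le:
  assumes "\<And>n. N (u n - L) \<le> g n" and "g \<longlonglongrightarrow> 0"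
  shows "u \<longlonglongrightarrow> L"
  unfolding tendsto_iff_N
  by (rule tendsto_sandwich[OF _ _ tendsto_const assms(2)]) (simp_all add: assms(1))

lemma tendsto_mult_left_N:
  fixes c L :: 'c
  assumes "u \<longlonglongrightarrow> L"
  shows "(\<lambda>n. c * u n) \<longlonglongrightarrow> c * L"
proof -
  have "(\<lambda>n. N c * N (u n - L)) \<longlonglongrightarrow> N c * 0"
    using assms by (intro tendsto_intros) (simp add: tendsto_iff_N)
  then show ?thesis
    by (simp add: tendsto_iff_N flip: N_mult right_diff_distrib)
qed

lemma tendsto_add_N:
  fixes L M :: 'c
  assumes "u \<longlonglongrightarrow> L" and "v \<longlonglongrightarrow> M"
  shows "(\<lambda>n. u n + v n) \<longlonglongrightarrow> L + M"
proof (rule tendsto_N_le)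
  show "N (u n + v n - (L + M)) \<le> N (u n - L) + N (v n - M)" for n
    using N_triangle[of "u n - L" "v n - M"] by (simp add: algebra_simps)
  show "(\<lambda>n. N (u n - L) + N (v n - M)) \<longlonglongrightarrow> 0"
    using tendsto_add[OF assms[unfolded tendsto_iff_N]] by simp
qed

lemma N_limit_le:
  assumes "u \<longlonglongrightarrow> L" and "\<And>n. N (u n) \<le> B"
  shows "N L \<le> B"
proof -
  have "(\<lambda>n. dist (u n) 0) \<longlonglongrightarrow> dist L 0"
    using assms(1) by (intro tendsto_intros)
  then show ?thesis
    using assms(2) by (intro LIMSEQ_le_const2[of "\<lambda>n. dist (u n) 0"]) (auto simp: N_eq_dist)
qed

lemma sums_mult_left_N: "f sums s \<Longrightarrow> (\<lambda>i. c * f i) sums (c * s)" for c s :: 'c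
  unfolding sums_def by (drule tendsto_mult_left_N[where c = c]) (simp add: sum_distrib_left)

lemma sums_add_N: "f sums s \<Longrightarrow> g sums t \<Longrightarrow> (\<lambda>i. f i + g i) sums (s + t)" for s t :: 'c
  unfolding sums_def by (drule (1) tendsto_add_N) (simp add: sum.distrib)

lemma sums_sum_N:
  fixes f :: "'b \<Rightarrow> nat \<Rightarrow> 'c"
  assumes "\<And>j. j \<in> A \<Longrightarrow> f j sums s j"
  shows "(\<lambda>i. \<Sum>j\<in>A. f j i) sums (\<Sum>j\<in>A. s j)"
  using assms
proof (induction A rule: infinite_finite_induct)
  case (insert x F)
  then show ?case
    by (simp add: sums_add_N)
qed (simp_all add: sums_def)

lemma N_sums_le:
  assumes "f sums s" and "\<And>i. N (f i) \<le> B"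
  shows "N s \<le> B"
proof (rule N_limit_le)
  show "(\<lambda>n. sum f {..<n}) \<longlonglongrightarrow> s"
    using assms(1) by (simp add: sums_def)
  show "N (sum f {..<n}) \<le> B" for n
    using assms(2) order_trans[OF N_nonneg assms(2)] by (intro N_sum_le) auto
qed

lemma sums_shift_zero_N:
  fixes s :: 'c
  assumes "(\<lambda>m. f (m + n)) sums s" and "\<And>i. i < n \<Longrightarrow> f i = 0"
  shows "f sums s"
  unfolding sums_def
proof (rule LIMSEQ_offset[where k = n])
  have "sum f {..<m + n} = (\<Sum>i<m. f (i + n))" for m
    using assms(2) by (induction m) auto
  then show "(\<lambda>m. sum f {..<m + n}) \<longlonglongrightarrow> s"
    using assms(1) by (simp add: sums_def)
qed

lemma N_sums_head_le:
  assumes "f sums s" and "\<And>i. N (f (Suc i)) \<le> B"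
  shows "N (s - f 0) \<le> B"
proof (rule N_sums_le)
  have "(\<lambda>n. (\<Sum>i<Suc n. f i) + (- f 0)) \<longlonglongrightarrow> s + (- f 0)"
    using LIMSEQ_Suc[OF assms(1)[unfolded sums_def]] by (rule tendsto_add_N) simp
  then show "(\<lambda>i. f (Suc i)) sums (s - f 0)"
    by (simp only: sums_def sum.lessThan_Suc_shift) simp
qed (rule assms(2))

text \<open>
  The ultrametric inequality bounds a block of consecutive terms by its largest member, so the
  partial sums form a Cauchy sequence as soon as the terms tend to zero.
\<close>

lemma summable_N:
  assumes "(\<lambda>n. N (f n)) \<longlonglongrightarrow> 0"
  shows "summable f"
proof -
  have "Cauchy (\<lambda>n. sum f {..<n})"
  proof (rule metric_CauchyI)
    fix e :: real
    assume "0 < e"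
    then obtain n0 where n0: "N (f n) < e / 2" if "n \<ge> n0" for n
      using order_tendstoD(2)[OF assms, of "e / 2"] by (auto simp: eventually_sequentially)
    have block: "N (sum f {..<m} - sum f {..<n}) < e" if "n0 \<le> n" "n \<le> m" for n m
    proof -
      have "sum f {..<m} - sum f {..<n} = sum f {n..<m}"
        using that by (simp add: sum_diff_nat_ivl lessThan_atLeast0)
      also have "N \<dots> \<le> e / 2"
        using that n0 \<open>0 < e\<close> by (intro N_sum_le) (auto intro: less_imp_le)
      finally show ?thesis
        using \<open>0 < e\<close> by linarith
    qed
    show "\<exists>M. \<forall>m\<ge>M. \<forall>n\<ge>M. dist (sum f {..<m}) (sum f {..<n}) < e"
      using block N_diff_commute by (metis dist_N nle_le)
  qed
  then show ?thesis
    by (simp add: Cauchy_convergent_iff summable_iff_convergent)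
qed

lemma sums_suminf_N: "(\<lambda>n. N (f n)) \<longlonglongrightarrow> 0 \<Longrightarrow> f sums suminf f"
  by (rule summable_sums[OF summable_N])

lemma sums_geometric_N:
  assumes "N x < 1"
  shows "(\<lambda>k. x ^ k) sums (1 / (1 - x))"
  unfolding sums_def
proof (rule tendsto_N_le)
  have "x \<noteq> 1"
    using assms by auto
  then have "(\<Sum>k<n. x ^ k) - 1 / (1 - x) = - (x ^ n / (1 - x))" for n
    by (simp add: sum_gp_strict diff_divide_distrib)
  then show "N ((\<Sum>k<n. x ^ k) - 1 / (1 - x)) \<le> N x ^ n / N (1 - x)" for n
    by (simp add: N_divide N_power)
  show "(\<lambda>n. N x ^ n / N (1 - x)) \<longlonglongrightarrow> 0"
    using LIMSEQ_power_zero[of "N x"] assms by (simp add: tendsto_divide_zero)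
qed

text \<open>
  In a nonzero power series the lowest nonzero term dominates near the origin, so the coefficients
  are determined by the values there; the points tending to \<open>0\<close> are powers of one \<open>x\<close>.
\<close>

lemma power_series_unique_N:
  assumes x: "x \<noteq> 0" "N x < 1"
    and sums: "\<And>t. N t \<le> 1 \<Longrightarrow> (\<lambda>m. a m * t ^ m) sums g t"
      "\<And>t. N t \<le> 1 \<Longrightarrow> (\<lambda>m. b m * t ^ m) sums g t"
  shows "a = b"
proof (rule ccontr)
  assume "a \<noteq> b"
  define c where "c m = a m - b m" for m
  have c_sums: "(\<lambda>m. c m * t ^ m) sums 0" if "N t \<le> 1" for t
    using sums_add_N[OF sums(1)[OF that] sums_mult_left_N[OF sums(2)[OF that], of "-1"]]
    by (simp add: c_def algebra_simps)
  have "\<exists>m. c m \<noteq> 0"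
    using \<open>a \<noteq> b\<close> by (auto simp: c_def)
  then obtain k where k: "c k \<noteq> 0" "\<And>m. m < k \<Longrightarrow> c m = 0"
    using exists_least_iff[of "\<lambda>m. c m \<noteq> 0"] by blast
  have "(\<lambda>m. c m) \<longlonglongrightarrow> 0"
  proof -
    have *: "(\<lambda>n. \<Sum>i<n. c i) \<longlonglongrightarrow> 0"
      using c_sums[of 1] by (simp add: sums_def)
    show ?thesis
      using tendsto_add_N[OF LIMSEQ_Suc[OF *] tendsto_mult_left_N[OF *, of "-1"]] by simp
  qed
  then have "Bseq (\<lambda>m. N (c m))"
    by (intro convergent_imp_Bseq convergentI[of _ 0]) (simp add: tendsto_iff_N)
  then obtain B where B: "0 < B" "\<And>m. N (c m) \<le> B"
    by (auto simp: Bseq_def)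
  have bound: "N (c k) \<le> B * N x ^ n" for n
  proof -
    define t where "t = x ^ n"
    have t: "t \<noteq> 0" "N t \<le> 1"
      using x by (auto simp: t_def N_power intro: power_le_one)
    have "(\<lambda>m. c (m + k) * t ^ (m + k)) sums 0"
    proof -
      have *: "(\<lambda>n. \<Sum>i<n+k. c i * t ^ i) \<longlonglongrightarrow> 0"
        using LIMSEQ_ignore_initial_segment[OF c_sums[OF t(2), unfolded sums_def], of k] .
      have "(\<Sum>i<n+k. c i * t ^ i) = (\<Sum>i<n. c (i + k) * t ^ (i + k))" for n
        using k(2) by (induction n) auto
      then show ?thesis
        using * by (simp add: sums_def)
    qed
    from sums_mult_left_N[OF this, of "inverse (t ^ k)"]
    have *: "(\<lambda>m. c (m + k) * t ^ m) sums 0"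
      using t by (simp add: power_add field_simps)
    have "N (c (Suc i + k) * t ^ Suc i) \<le> B * N t" for i
    proof -
      have "N t * N t ^ i \<le> N t * 1"
        using t by (intro mult_left_mono power_le_one) auto
      then show ?thesis
        unfolding N_mult N_power power_Suc using B by (intro mult_mono) auto
    qed
    from N_sums_head_le[OF * this] show ?thesis
      by (simp add: t_def N_power)
  qed
  have "(\<lambda>n. B * N x ^ n) \<longlonglongrightarrow> B * 0"
    using x by (intro tendsto_intros LIMSEQ_power_zero) simp
  then have "N (c k) \<le> 0"
    using bound by (intro LIMSEQ_le_const[of "\<lambda>n. B * N x ^ n"]) auto
  then show False
    using k(1) N_pos_iff not_less by blast
qed

end

section \<open>The division tower of the Carlitz module\<close>

locale carlitz = ultrametric_field N
  for N :: "'c::{field,complete_space} \<Rightarrow> real" +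
  fixes q :: nat and \<theta> r :: 'c
  assumes q_ge_2: "2 \<le> q"
    and frobenius: "(x + y :: 'c) ^ q = x ^ q + y ^ q"
    and N_theta: "N \<theta> = real q"
    and r_root: "r ^ (q - 1) = - \<theta>"
begin

lemma q_pos: "0 < q" and q_gt_1: "1 < real q"
  using q_ge_2 by auto

lemma theta_nonzero [simp]: "\<theta> \<noteq> 0"
  using N_theta q_pos by (metis N_0 of_nat_0_less_iff less_irrefl)

lemma r_nonzero [simp]: "r \<noteq> 0"
  using r_root q_ge_2 by (auto simp: power_0_left split: if_splits)

lemma N_r_pow: "N r ^ (q - 1) = real q"
  using arg_cong[OF r_root, of N] by (simp add: N_power N_theta)

lemma r_pow_q: "r ^ q = - \<theta> * r"
  using r_root power_Suc2[of r "q - 1"] q_pos by simp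

lemma frobenius_power: "(x + y) ^ (q ^ n) = x ^ (q ^ n) + y ^ (q ^ n)" for x y :: 'c
proof (induction n)
  case (Suc n)
  then show ?case
    by (simp only: power_Suc2 power_mult frobenius)
qed simp

lemma frobenius_minus: "(- x) ^ (q ^ n) = - (x ^ (q ^ n))" for x :: 'c
  using frobenius_power[of x "- x" n] q_pos
  by (simp add: zero_power eq_neg_iff_add_eq_0 add.commute)

lemma frobenius_diff: "(x - y) ^ (q ^ n) = x ^ (q ^ n) - y ^ (q ^ n)" for x y :: 'c
  using frobenius_power[of x "- y" n] by (simp add: frobenius_minus)

lemma frobenius_diff': "(x - y) ^ q = x ^ q - y ^ q" for x y :: 'c
  using frobenius_diff[of x y 1] by simp

lemma frobenius_sum: "(sum f A) ^ q = (\<Sum>i\<in>A. f i ^ q)" for f :: "_ \<Rightarrow> 'c"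
  using q_pos by (induction A rule: infinite_finite_induct) (auto simp: frobenius zero_power)

lemma sums_frobenius:
  fixes s :: 'c
  assumes "f sums s"
  shows "(\<lambda>i. f i ^ q) sums (s ^ q)"
proof -
  have "(\<lambda>n. N (sum f {..<n} - s) ^ q) \<longlonglongrightarrow> 0 ^ q"
    using assms by (intro tendsto_power) (simp add: sums_def tendsto_iff_N)
  then show ?thesis
    using q_pos by (simp add: sums_def tendsto_iff_N zero_power flip: N_power frobenius_diff' frobenius_sum)
qed

text \<open>
  On the disc of radius \<open>N r / q\<close> the \<open>q\<close>-th power map contracts distances, so the equation can be
  solved for \<open>x\<close> by iterating \<open>x \<mapsto> (y - x ^ q) / \<theta>\<close>.
\<close>

lemma carlitz_division:
  assumes "N y \<le> N r"
  obtains x where "\<theta> * x + x ^ q = y" "N x = N y / real q"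
proof -
  define f where "f x = (y - x ^ q) / \<theta>" for x
  define S where "S = cball (0::'c) (N r / real q)"
  have S_iff: "x \<in> S \<longleftrightarrow> N x \<le> N r / real q" for x
    by (simp add: S_def dist_N)
  have N_r_q: "N r ^ q = real q * N r"
    using arg_cong[OF r_pow_q, of N] by (simp add: N_power N_mult N_theta)
  have pow_small: "N x ^ q \<le> N r / real q" if "x \<in> S" for x
  proof -
    have "N x ^ q \<le> (N r / real q) ^ q"
      using that by (intro power_mono) (simp_all add: S_iff)
    also have "\<dots> = real q * N r / real q ^ q"
      by (simp add: power_divide N_r_q)
    also have "\<dots> \<le> real q * N r / real q ^ 2"
      using q_ge_2 by (intro divide_left_mono power_increasing mult_nonneg_nonneg mult_pos_pos) auto
    also have "\<dots> = N r / real q"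
      using q_pos by (simp add: power2_eq_square)
    finally show ?thesis .
  qed
  have "\<exists>!x\<in>S. f x = x"
  proof (rule Banach_fix)
    show "complete S"
      by (simp add: S_def complete_eq_closed)
    show "S \<noteq> {}"
      using S_iff[of 0] by auto
    show "0 \<le> 1 / real q" "1 / real q < 1"
      using q_ge_2 by auto
    show "f ` S \<subseteq> S"
    proof safe
      fix x assume "x \<in> S"
      then have "N x ^ q \<le> N r"
        using pow_small[of x] q_ge_2 divide_left_mono[of 1 "real q" "N r"] by simp
      then have "N (y - x ^ q) \<le> N r"
        using N_diff[of y "x ^ q"] assms by (simp add: N_power)
      then show "f x \<in> S"
        using q_pos by (simp add: f_def S_iff N_divide N_theta divide_right_mono)
    qed
    fix x x' assume "x \<in> S" "x' \<in> S"
    then have "N (x - x') \<le> N r / real q"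
      using N_diff[of x x'] by (simp add: S_iff)
    then have "N (x - x') ^ (q - 1) \<le> (N r / real q) ^ (q - 1)"
      by (rule power_mono) simp
    also have "\<dots> = real q / real q ^ (q - 1)"
      by (simp only: power_divide N_r_pow)
    also have "\<dots> \<le> real q / real q ^ 1"
      using q_ge_2 by (intro divide_left_mono power_increasing mult_pos_pos) auto
    finally have "N (x - x') ^ (q - 1) * N (x - x') \<le> 1 * N (x - x')"
      using q_pos by (intro mult_right_mono) auto
    then have *: "N (x - x') ^ q \<le> N (x - x')"
      using q_pos by (simp flip: power_Suc2)
    have "f x - f x' = - ((x - x') ^ q / \<theta>)"
      by (simp add: f_def frobenius_diff' diff_divide_distrib)
    then have "dist (f x) (f x') = N (x - x') ^ q / real q"
      by (simp add: dist_N N_divide N_power N_theta)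
    then show "dist (f x) (f x') \<le> 1 / real q * dist x x'"
      using * q_pos by (simp add: dist_N divide_right_mono)
  qed
  then obtain x where x: "x \<in> S" "f x = x"
    by blast
  have eq: "\<theta> * x + x ^ q = y"
    using x(2) by (simp add: f_def field_simps)
  moreover have "N x = N y / real q"
  proof (cases "x = 0")
    case True
    then show ?thesis
      using eq q_pos by (simp add: power_0_left)
  next
    case False
    have "N x ^ (q - 1) \<le> (N r / real q) ^ (q - 1)"
      using x(1) by (intro power_mono) (simp_all add: S_iff)
    also have "\<dots> = real q / real q ^ (q - 1)"
      by (simp only: power_divide N_r_pow)
    also have "\<dots> \<le> real q / real q ^ 1"
      using q_ge_2 by (intro divide_left_mono power_increasing mult_pos_pos) auto
    finally have "N x ^ (q - 1) * N x \<le> 1 * N x"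
      using q_pos by (intro mult_right_mono) auto
    also have "\<dots> < real q * N x"
      using False q_ge_2 by (intro mult_strict_right_mono) auto
    finally have "N (x ^ q) < N (\<theta> * x)"
      using q_pos by (simp add: N_power N_mult N_theta flip: power_Suc2)
    from N_add_dominant[OF this] show ?thesis
      using q_pos by (simp add: eq N_mult N_theta)
  qed
  ultimately show thesis
    using that by blast
qed

lemma exists_division_tower:
  "\<exists>w. w 0 = r \<and> (\<forall>i. \<theta> * w (Suc i) + w (Suc i) ^ q = w i) \<and> (\<forall>i. N (w i) = N r / real q ^ i)"
proof -
  have "\<exists>w. \<forall>i. (N (w i) = N r / real q ^ i \<and> (i = 0 \<longrightarrow> w i = r)) \<and>
      \<theta> * w (Suc i) + w (Suc i) ^ q = w i"
  proof (rule dependent_nat_choice)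
    show "\<exists>x. N x = N r / real q ^ 0 \<and> (0 = (0::nat) \<longrightarrow> x = r)"
      by auto
  next
    fix x and i :: nat
    assume x: "N x = N r / real q ^ i \<and> (i = 0 \<longrightarrow> x = r)"
    have "N x \<le> N r"
    proof -
      have "N r / real q ^ i \<le> N r / 1"
        using q_ge_2 by (intro divide_left_mono) auto
      then show ?thesis
        using x by simp
    qed
    then show "\<exists>y. (N y = N r / real q ^ Suc i \<and> (Suc i = 0 \<longrightarrow> y = r)) \<and> \<theta> * y + y ^ q = x"
      using x by (elim carlitz_division[of x]) (auto simp: field_simps)
  qed
  then show ?thesis
    by blast
qed

text \<open>
  The tower \<open>w\<close> of successive division points of \<open>r\<close>: it is the sequence of coefficients of the
  Anderson--Thakur function, and also the sequence of values \<open>exp (\<pi> / \<theta> ^ (i + 1))\<close>.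
\<close>

definition w :: "nat \<Rightarrow> 'c" where
  "w = (SOME w. w 0 = r \<and> (\<forall>i. \<theta> * w (Suc i) + w (Suc i) ^ q = w i) \<and>
         (\<forall>i. N (w i) = N r / real q ^ i))"

lemma w_0: "w 0 = r"
  and w_Suc: "\<theta> * w (Suc i) + w (Suc i) ^ q = w i"
  and N_w: "N (w i) = N r / real q ^ i"
  using someI_ex[OF exists_division_tower] unfolding w_def[symmetric] by auto

lemma theta_w_0: "\<theta> * w 0 + w 0 ^ q = 0"
  by (simp add: w_0 r_pow_q)

section \<open>The product formulas\<close>

text \<open>
  Twisting the coefficients of \<open>\<Sum> w i * t ^ i\<close> by the \<open>n\<close>-th power of Frobenius widens the disc of
  convergence, and the leading term \<open>r ^ (q ^ n)\<close> comes to dominate; the recursion of the tower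
  relates each twist to the next by a linear factor.
\<close>

definition twist :: "nat \<Rightarrow> 'c \<Rightarrow> 'c" where
  "twist n t = (\<Sum>i. w i ^ (q ^ n) * t ^ i)"

lemma N_twist_term: "N (w i ^ (q ^ n) * t ^ i) = N r ^ (q ^ n) * (N t / real q ^ (q ^ n)) ^ i"
  by (simp add: N_mult N_power N_w power_divide mult.commute flip: power_mult)

lemma q_pow_split: "real q ^ (q ^ n) = real q * real q ^ (q ^ n - 1)"
  using q_pos by (metis power_eq_if not_less0 zero_less_power power_eq_0_iff neq0_conv)

lemma N_twist_ratio:
  assumes "N t \<le> real q ^ (q ^ n - 1)"
  shows "N t / real q ^ (q ^ n) \<le> 1 / real q"
proof -
  have "N t / real q ^ (q ^ n) \<le> real q ^ (q ^ n - 1) / real q ^ (q ^ n)"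
    using q_pos assms by (intro divide_right_mono) auto
  also have "\<dots> = 1 / real q"
    using q_pos by (subst q_pow_split) simp
  finally show ?thesis .
qed

lemma N_twist_ratio_less:
  assumes "N t \<le> real q ^ (q ^ n - 1)"
  shows "N t / real q ^ (q ^ n) < 1"
proof -
  have "1 / real q < 1"
    using q_ge_2 by simp
  then show ?thesis
    using N_twist_ratio[OF assms] by linarith
qed

lemma twist_sums:
  assumes "N t \<le> real q ^ (q ^ n - 1)"
  shows "(\<lambda>i. w i ^ (q ^ n) * t ^ i) sums twist n t"
  unfolding twist_def
proof (rule sums_suminf_N)
  have "(\<lambda>i. N r ^ (q ^ n) * (N t / real q ^ (q ^ n)) ^ i) \<longlonglongrightarrow> N r ^ (q ^ n) * 0"
    using N_twist_ratio_less[OF assms] by (intro tendsto_intros LIMSEQ_power_zero) simp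
  then show "(\<lambda>i. N (w i ^ (q ^ n) * t ^ i)) \<longlonglongrightarrow> 0"
    by (simp add: N_twist_term)
qed

lemma N_twist_diff_le:
  assumes "N t \<le> real q ^ (q ^ n - 1)"
  shows "N (twist n t - r ^ (q ^ n)) \<le> N r ^ (q ^ n) * (N t / real q ^ (q ^ n))"
proof -
  have ratio: "0 \<le> N t / real q ^ (q ^ n)" "N t / real q ^ (q ^ n) < 1"
    using N_twist_ratio_less[OF assms] by auto
  have "N (w (Suc i) ^ (q ^ n) * t ^ Suc i) \<le> N r ^ (q ^ n) * (N t / real q ^ (q ^ n))" for i
    unfolding N_twist_term using ratio power_le_one[of "N t / real q ^ (q ^ n)" i]
    by (intro mult_left_mono) (simp_all add: mult_left_le del: times_divide_eq_left)
  from N_sums_head_le[OF twist_sums[OF assms] this] show ?thesis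
    by (simp add: w_0)
qed

lemma N_twist:
  assumes "N t \<le> real q ^ (q ^ n - 1)"
  shows "N (twist n t) = N r ^ (q ^ n)"
proof -
  have "N (twist n t - r ^ (q ^ n)) < N (r ^ (q ^ n))"
    using N_twist_diff_le[OF assms] mult_strict_left_mono[OF N_twist_ratio_less[OF assms], of "N r ^ (q ^ n)"]
    by (simp add: N_power)
  from N_add_dominant[OF this] show ?thesis
    by (simp add: N_power)
qed

lemma twist_nonzero: "N t \<le> real q ^ (q ^ n - 1) \<Longrightarrow> twist n t \<noteq> 0"
  using N_twist[of t n] by auto

lemma q_pow_mono: "m \<le> n \<Longrightarrow> real q ^ (q ^ m - 1) \<le> real q ^ (q ^ n - 1)"
  using q_ge_2 by (intro power_increasing diff_le_mono) auto

lemma twist_Suc: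
  assumes "N t \<le> real q ^ (q ^ n - 1)"
  shows "twist (Suc n) t = (t - \<theta> ^ (q ^ n)) * twist n t"
proof -
  have coeff: "w i ^ (q ^ Suc n) + \<theta> ^ (q ^ n) * w i ^ (q ^ n) =
      (case i of 0 \<Rightarrow> 0 | Suc j \<Rightarrow> w j ^ (q ^ n))" for i
  proof -
    have "w i ^ (q ^ Suc n) + \<theta> ^ (q ^ n) * w i ^ (q ^ n) = (\<theta> * w i + w i ^ q) ^ (q ^ n)"
      by (simp add: frobenius_power power_mult power_mult_distrib add.commute)
    then show ?thesis
      using q_pos by (cases i) (simp_all add: theta_w_0 w_Suc)
  qed
  have "N t \<le> real q ^ (q ^ Suc n - 1)"
    using assms q_pow_mono[of n "Suc n"] by simp
  from sums_add_N[OF twist_sums[OF this] sums_mult_left_N[OF twist_sums[OF assms], of "\<theta> ^ (q ^ n)"]]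
  have "(\<lambda>i. (case i of 0 \<Rightarrow> 0 | Suc j \<Rightarrow> w j ^ (q ^ n)) * t ^ i) sums
      (twist (Suc n) t + \<theta> ^ (q ^ n) * twist n t)"
    by (simp add: coeff algebra_simps flip: coeff distrib_right mult.assoc)
  moreover have "(\<lambda>i. (case i of 0 \<Rightarrow> 0 | Suc j \<Rightarrow> w j ^ (q ^ n)) * t ^ i) sums (t * twist n t)"
  proof (rule sums_shift_zero_N[where n = 1])
    show "(\<lambda>m. (case m + 1 of 0 \<Rightarrow> 0 | Suc j \<Rightarrow> w j ^ (q ^ n)) * t ^ (m + 1)) sums (t * twist n t)"
      using sums_mult_left_N[OF twist_sums[OF assms], of t] by (simp add: algebra_simps)
  qed simp
  ultimately have "twist (Suc n) t + \<theta> ^ (q ^ n) * twist n t = t * twist n t"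
    by (rule sums_unique2)
  then show ?thesis
    by (simp add: algebra_simps)
qed

lemma r_pow_Suc: "r ^ (q ^ Suc n) = - (\<theta> ^ (q ^ n)) * r ^ (q ^ n)"
proof -
  have "r ^ (q ^ Suc n) = (- (\<theta> * r)) ^ (q ^ n)"
    by (simp add: power_mult r_pow_q)
  then show ?thesis
    by (simp add: frobenius_minus power_mult_distrib)
qed

text \<open>
  Dividing the two recursions, \<open>twist n t / r ^ (q ^ n)\<close> acquires the factor \<open>1 - t / \<theta> ^ (q ^ n)\<close>
  at each step while tending to \<open>1\<close>, which evaluates the infinite product.
\<close>

lemma twist_has_prod:
  assumes t: "N t \<le> real q ^ (q ^ M - 1)"
  shows "(\<lambda>i. inverse (1 - t / \<theta> ^ (q ^ (M + i)))) has_prod (twist M t / r ^ (q ^ M))"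
proof -
  \<comment> \<open>Both recursions enter through \<open>g\<close>, whose absolute value is \<open>1\<close> and whose limit is \<open>1\<close>.\<close>
  define g where "g n = twist n t / r ^ (q ^ n)" for n
  have t_n: "N t \<le> real q ^ (q ^ (M + n) - 1)" for n
    using t q_pow_mono[of M "M + n"] by simp
  have g_nonzero: "g (M + n) \<noteq> 0" for n
    using twist_nonzero[OF t_n] by (simp add: g_def)
  have g_Suc: "g (Suc (M + n)) = (1 - t / \<theta> ^ (q ^ (M + n))) * g (M + n)" for n
    unfolding g_def twist_Suc[OF t_n] r_pow_Suc by (simp add: field_simps)
  have partial: "(\<Prod>i<n. inverse (1 - t / \<theta> ^ (q ^ (M + i)))) = g M / g (M + n)" for n
  proof (induction n)
    case (Suc n)
    have "1 - t / \<theta> ^ (q ^ (M + n)) \<noteq> 0"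
      using g_Suc[of n] g_nonzero[of "Suc n"] by auto
    then show ?case
      using Suc g_nonzero[of n] by (simp add: g_Suc divide_inverse mult_ac)
  qed (use g_nonzero[of 0] in simp)
  have "(\<lambda>n. \<Prod>i<n. inverse (1 - t / \<theta> ^ (q ^ (M + i)))) \<longlonglongrightarrow> g M"
  proof (rule tendsto_N_le)
    fix n
    have N_g: "N (g (M + n)) = 1" for n
      using N_twist[OF t_n, of n] by (simp add: g_def N_divide N_power)
    have "g M / g (M + n) - g M = - (g M / g (M + n) * (g (M + n) - 1))"
      using g_nonzero[of n] by (simp add: field_simps)
    then have "N (g M / g (M + n) - g M) = N (g (M + n) - 1)"
      using N_g[of 0] N_g[of n] by (simp add: N_mult N_divide)
    also have "g (M + n) - 1 = (twist (M + n) t - r ^ (q ^ (M + n))) / r ^ (q ^ (M + n))"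
      by (simp add: g_def field_simps)
    also have "N \<dots> \<le> N t / real q ^ (q ^ (M + n))"
      using N_twist_diff_le[OF t_n, of n] by (simp add: N_divide N_power field_simps)
    also have "\<dots> \<le> N t * (1 / real q) ^ n"
    proof -
      have "n \<le> q ^ (M + n)"
        using power_gt_expt[of q "M + n"] q_ge_2 by simp
      then have "real q ^ n \<le> real q ^ (q ^ (M + n))"
        using q_ge_2 by (intro power_increasing) auto
      then show ?thesis
        using q_pos by (simp add: power_divide divide_left_mono)
    qed
    finally show "N ((\<Prod>i<n. inverse (1 - t / \<theta> ^ (q ^ (M + i)))) - g M) \<le> N t * (1 / real q) ^ n"
      by (simp add: partial)
  next
    have "(\<lambda>n. N t * (1 / real q) ^ n) \<longlonglongrightarrow> N t * 0"
      using q_ge_2 by (intro tendsto_intros LIMSEQ_power_zero) auto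
    then show "(\<lambda>n. N t * (1 / real q) ^ n) \<longlonglongrightarrow> 0"
      by simp
  qed
  from LIMSEQ_Suc[OF this] g_nonzero[of 0] show ?thesis
    by (simp add: has_prod_def raw_has_prod_def lessThan_Suc_atMost g_def)
qed

lemma anderson_thakur_sums:
  assumes "N t \<le> 1"
  shows "(\<lambda>i. w i * t ^ i) sums anderson_thakur q \<theta> r t"
proof -
  have "anderson_thakur q \<theta> r t = twist 0 t"
    using has_prod_unique[OF twist_has_prod[of t 0], symmetric] assms
    by (simp add: anderson_thakur_def)
  then show ?thesis
    using twist_sums[of t 0] assms by simp
qed

lemma anderson_thakur_fps_eq: "anderson_thakur_fps q \<theta> r = Abs_fps w"
  unfolding anderson_thakur_fps_def
proof (rule the_equality)
  show "\<forall>t. dist t 0 \<le> 1 \<longrightarrow> (\<lambda>m. fps_nth (Abs_fps w) m * t ^ m) sums anderson_thakur q \<theta> r t"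
    using anderson_thakur_sums by (simp add: N_eq_dist)
next
  fix W
  assume "\<forall>t. dist t 0 \<le> 1 \<longrightarrow> (\<lambda>m. fps_nth W m * t ^ m) sums anderson_thakur q \<theta> r t"
  moreover have "N (inverse \<theta>) < 1"
    unfolding N_inverse N_theta using q_ge_2 by (simp add: field_simps)
  ultimately have "fps_nth W = w"
    using anderson_thakur_sums
    by (intro power_series_unique_N[of "inverse \<theta>"]) (auto simp: N_eq_dist[symmetric])
  then show "W = Abs_fps w"
    by (simp add: fps_eq_iff)
qed

text \<open>
  The number \<open>\<pi>\<close> is minus the residue of the Anderson--Thakur function at \<open>\<theta>\<close>, that is
  \<open>- twist 1 \<theta>\<close>, and that series telescopes.
\<close>

lemma carlitz_pi_eq: "carlitz_pi q \<theta> r = - twist 1 \<theta>"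
proof -
  have exponent: "\<theta> powi (1 - int (q ^ Suc i)) = \<theta> / \<theta> ^ (q ^ (1 + i))" for i
    by (simp only: power_int_diff[OF disjI1[OF theta_nonzero]] power_int_of_nat power_int_1_right) simp
  have "N \<theta> \<le> real q ^ (q ^ 1 - 1)"
    using q_ge_2 power_increasing[of 1 "q - 1" "real q"] by (simp add: N_theta)
  from has_prod_unique[OF twist_has_prod[OF this]]
  have "carlitz_pi q \<theta> r = \<theta> * r * (twist 1 \<theta> / r ^ q)"
    unfolding carlitz_pi_def exponent by simp
  then show ?thesis
    by (simp add: r_pow_q)
qed

lemma tower_tendsto_pi: "(\<lambda>n. \<theta> ^ Suc n * w n) \<longlonglongrightarrow> carlitz_pi q \<theta> r"
proof -
  have "(\<Sum>i<Suc n. w i ^ (q ^ 1) * \<theta> ^ i) = - (\<theta> ^ Suc n * w n)" for n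
  proof (induction n)
    case 0
    then show ?case
      using theta_w_0 by (simp add: eq_neg_iff_add_eq_0 add.commute)
  next
    case (Suc n)
    have w_q: "w (Suc n) ^ q = w n - \<theta> * w (Suc n)"
      using w_Suc[of n] by (simp add: algebra_simps)
    show ?case
      unfolding sum.lessThan_Suc[of _ "Suc n"] Suc by (simp add: w_q algebra_simps)
  qed
  moreover have "N \<theta> \<le> real q ^ (q ^ 1 - 1)"
    using q_ge_2 power_increasing[of 1 "q - 1" "real q"] by (simp add: N_theta)
  from LIMSEQ_Suc[OF twist_sums[OF this, unfolded sums_def]]
  have "(\<lambda>n. \<Sum>i<Suc n. w i ^ (q ^ 1) * \<theta> ^ i) \<longlonglongrightarrow> twist 1 \<theta>" .
  ultimately have "(\<lambda>n. - (\<theta> ^ Suc n * w n)) \<longlonglongrightarrow> twist 1 \<theta>"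
    by simp
  from tendsto_mult_left_N[OF this, of "-1"] show ?thesis
    by (simp add: carlitz_pi_eq)
qed

section \<open>The Carlitz exponential at the points of the tower\<close>

lemma carlitz_d_Suc: "carlitz_d q \<theta> (Suc n) = (\<theta> ^ (q ^ Suc n) - \<theta>) * carlitz_d q \<theta> n ^ q"
proof -
  have "\<theta> ^ (q ^ Suc n) - \<theta> ^ (q ^ Suc i) = (\<theta> ^ (q ^ n) - \<theta> ^ (q ^ i)) ^ q" for i
    by (simp only: frobenius_diff' power_Suc2 power_mult)
  then show ?thesis
    by (simp only: carlitz_d_def prod.lessThan_Suc_shift prod_power_distrib power_0 power_one_right)
qed

lemma N_carlitz_d: "N (carlitz_d q \<theta> n) = (real q ^ n) ^ (q ^ n)"
proof -
  have "N (\<theta> ^ (q ^ n) - \<theta> ^ (q ^ i)) = real q ^ (q ^ n)" if "i < n" for i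
  proof -
    have "real q ^ (q ^ i) < real q ^ (q ^ n)"
      using that q_ge_2 by (intro power_strict_increasing) auto
    then have "N (- (\<theta> ^ (q ^ i))) < N (\<theta> ^ (q ^ n))"
      by (simp add: N_power N_theta)
    from N_add_dominant[OF this] show ?thesis
      by (simp add: N_power N_theta)
  qed
  moreover have "N (prod f {..<k}) = (\<Prod>i<k. N (f i))" for f :: "nat \<Rightarrow> 'c" and k
    by (induction k) (simp_all add: N_mult)
  ultimately show ?thesis
    by (simp add: carlitz_d_def mult.commute flip: power_mult)
qed

lemma carlitz_d_nonzero: "carlitz_d q \<theta> n \<noteq> 0"
  using N_carlitz_d[of n] q_pos by (metis N_0 of_nat_0_less_iff less_irrefl zero_less_power)

lemma N_carlitz_exp_term: "N (z ^ (q ^ n) / carlitz_d q \<theta> n) = (N z / real q ^ n) ^ (q ^ n)"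
  by (simp add: N_divide N_power N_carlitz_d power_divide)

lemma carlitz_exp_sums: "(\<lambda>n. z ^ (q ^ n) / carlitz_d q \<theta> n) sums carlitz_exp q \<theta> z"
  unfolding carlitz_exp_def
proof (rule sums_suminf_N)
  have "(\<lambda>n. N z * (1 / real q) ^ n) \<longlonglongrightarrow> N z * 0"
    using q_ge_2 by (intro tendsto_intros LIMSEQ_power_zero) auto
  then have "(\<lambda>n. N z / real q ^ n) \<longlonglongrightarrow> 0"
    by (simp add: power_divide)
  then have "\<forall>\<^sub>F n in sequentially. N z / real q ^ n < 1 / 2"
    by (rule order_tendstoD) simp
  then have "\<forall>\<^sub>F n in sequentially. N (z ^ (q ^ n) / carlitz_d q \<theta> n) \<le> (1 / 2) ^ n"
  proof eventually_elim
    case (elim n)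
    then have "(N z / real q ^ n) ^ (q ^ n) \<le> (1 / 2) ^ (q ^ n)"
      by (intro power_mono) auto
    also have "\<dots> \<le> (1 / 2) ^ n"
      using power_gt_expt[of q n] q_ge_2 by (intro power_decreasing) auto
    finally show ?case
      unfolding N_carlitz_exp_term .
  qed
  then show "(\<lambda>n. N (z ^ (q ^ n) / carlitz_d q \<theta> n)) \<longlonglongrightarrow> 0"
    by (intro tendsto_sandwich[OF _ _ tendsto_const LIMSEQ_power_zero[of "1 / 2 :: real"]]) auto
qed

lemma carlitz_exp_add: "carlitz_exp q \<theta> (x + y) = carlitz_exp q \<theta> x + carlitz_exp q \<theta> y"
  using sums_add_N[OF carlitz_exp_sums[of x] carlitz_exp_sums[of y]] carlitz_exp_sums[of "x + y"]
  by (intro sums_unique2[of _ "carlitz_exp q \<theta> (x + y)"])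
    (simp_all add: frobenius_power add_divide_distrib)

lemma carlitz_exp_scale:
  assumes "c ^ q = c"
  shows "carlitz_exp q \<theta> (c * z) = c * carlitz_exp q \<theta> z"
proof -
  have "c ^ (q ^ n) = c" for n
    by (induction n) (simp_all only: power_0 power_one_right power_Suc2 power_mult assms)
  then show ?thesis
    using sums_mult_left_N[OF carlitz_exp_sums[of z], of c] carlitz_exp_sums[of "c * z"]
    by (intro sums_unique2[of _ "carlitz_exp q \<theta> (c * z)"]) (simp_all add: power_mult_distrib)
qed

lemma carlitz_exp_0: "carlitz_exp q \<theta> 0 = 0"
  using carlitz_exp_add[of 0 0] by (metis add.right_neutral add_left_cancel)

lemma carlitz_exp_diff: "carlitz_exp q \<theta> (x - y) = carlitz_exp q \<theta> x - carlitz_exp q \<theta> y"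
  using carlitz_exp_add[of "x - y" y] by simp

lemma carlitz_exp_sum: "carlitz_exp q \<theta> (sum f A) = (\<Sum>i\<in>A. carlitz_exp q \<theta> (f i))"
  by (induction A rule: infinite_finite_induct) (simp_all add: carlitz_exp_0 carlitz_exp_add)

text \<open>
  The coefficients satisfy \<open>d (n + 1) = (\<theta> ^ (q ^ (n + 1)) - \<theta>) * d n ^ q\<close>, and this is the identity
  of the coefficients of \<open>z ^ (q ^ (n + 1))\<close> on the two sides.
\<close>

lemma carlitz_exp_theta:
  "carlitz_exp q \<theta> (\<theta> * z) = \<theta> * carlitz_exp q \<theta> z + carlitz_exp q \<theta> z ^ q"
proof -
  define f where "f z n = z ^ (q ^ n) / carlitz_d q \<theta> n" for z n
  define g where "g n = (case n of 0 \<Rightarrow> 0 | Suc m \<Rightarrow> f z m ^ q)" for n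
  have f_sums: "f z sums carlitz_exp q \<theta> z" for z
    unfolding f_def by (rule carlitz_exp_sums)
  have "g sums (carlitz_exp q \<theta> z ^ q)"
    by (rule sums_shift_zero_N[where n = 1])
      (use sums_frobenius[OF f_sums[of z]] in \<open>simp_all add: g_def\<close>)
  from sums_add_N[OF sums_mult_left_N[OF f_sums[of z], of \<theta>] this]
  have "(\<lambda>n. \<theta> * f z n + g n) sums (\<theta> * carlitz_exp q \<theta> z + carlitz_exp q \<theta> z ^ q)" .
  moreover have "\<theta> * f z n + g n = f (\<theta> * z) n" for n
  proof (cases n)
    case 0
    then show ?thesis
      by (simp add: f_def g_def carlitz_d_def)
  next
    case (Suc m)
    have "\<theta> ^ (q ^ Suc m) - \<theta> \<noteq> 0"
      using carlitz_d_nonzero[of "Suc m"] unfolding carlitz_d_Suc by auto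
    moreover have "f z m ^ q = z ^ (q ^ Suc m) / carlitz_d q \<theta> m ^ q"
      by (simp only: f_def power_divide power_Suc2 flip: power_mult)
    ultimately show ?thesis
      using carlitz_d_nonzero[of m] unfolding Suc f_def g_def carlitz_d_Suc power_mult_distrib
      by (simp add: f_def field_simps del: power_Suc)
  qed
  ultimately show ?thesis
    using f_sums[of "\<theta> * z"] by (intro sums_unique2[of "f (\<theta> * z)"]) simp_all
qed

lemma N_carlitz_exp_minus_le:
  assumes "N z \<le> 1"
  shows "N (carlitz_exp q \<theta> z - z) \<le> N z ^ 2"
proof -
  have "N (z ^ (q ^ Suc i) / carlitz_d q \<theta> (Suc i)) \<le> N z ^ 2" for i
  proof -
    have "N z / real q ^ Suc i \<le> N z / 1"
      using q_ge_2 by (intro divide_left_mono one_le_power) auto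
    then have "(N z / real q ^ Suc i) ^ (q ^ Suc i) \<le> N z ^ (q ^ Suc i)"
      by (intro power_mono) auto
    also have "\<dots> \<le> N z ^ 2"
      using assms q_ge_2 order_trans[OF q_ge_2 self_le_power[of q "Suc i"]]
      by (intro power_decreasing) simp_all
    finally show ?thesis
      unfolding N_carlitz_exp_term .
  qed
  from N_sums_head_le[OF carlitz_exp_sums this] show ?thesis
    by (simp add: carlitz_d_def)
qed

lemma N_carlitz_exp_le:
  assumes "N z \<le> 1"
  shows "N (carlitz_exp q \<theta> z) \<le> N z"
proof -
  have "N z ^ 2 \<le> N z"
    using assms mult_left_le[of "N z" "N z"] by (simp add: power2_eq_square)
  then show ?thesis
    using N_add[of "carlitz_exp q \<theta> z - z" z] N_carlitz_exp_minus_le[OF assms] by simp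
qed

text \<open>
  An additive map is continuous once it is continuous at \<open>0\<close>.
\<close>

lemma carlitz_exp_tendsto:
  assumes "u \<longlonglongrightarrow> L"
  shows "(\<lambda>n. carlitz_exp q \<theta> (u n)) \<longlonglongrightarrow> carlitz_exp q \<theta> L"
proof -
  have lim: "(\<lambda>n. N (u n - L)) \<longlonglongrightarrow> 0"
    using assms by (simp add: tendsto_iff_N)
  then have "\<forall>\<^sub>F n in sequentially. N (u n - L) < 1"
    by (rule order_tendstoD) simp
  then have "\<forall>\<^sub>F n in sequentially. N (carlitz_exp q \<theta> (u n) - carlitz_exp q \<theta> L) \<le> N (u n - L)"
    by eventually_elim (simp add: N_carlitz_exp_le flip: carlitz_exp_diff)
  then show ?thesis
    unfolding tendsto_iff_N by (intro tendsto_sandwich[OF _ _ tendsto_const lim]) auto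
qed

abbreviation \<pi> :: 'c where
  "\<pi> \<equiv> carlitz_pi q \<theta> r"

text \<open>
  Both sequences satisfy the recursion of the tower, so their difference \<open>\<delta>\<close> does as well, and such
  a sequence, once small, shrinks by no more than a factor \<open>q\<close> per step. But \<open>q ^ i * N (\<delta> i)\<close>
  tends to \<open>0\<close>, because each sequence is asymptotic to \<open>\<pi> / \<theta> ^ (i + 1)\<close>; hence \<open>\<delta> = 0\<close>.
\<close>

lemma carlitz_exp_pi_div: "carlitz_exp q \<theta> (\<pi> / \<theta> ^ Suc i) = w i"
proof -
  define z where "z n = \<pi> / \<theta> ^ Suc n" for n
  define \<delta> where "\<delta> n = carlitz_exp q \<theta> (z n) - w n" for n
  define \<epsilon> where "\<epsilon> n = real q ^ Suc n * N (\<delta> n)" for n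
  have N_z: "N (z n) = N \<pi> / real q ^ Suc n" for n
    by (simp add: z_def N_divide N_mult N_power N_theta)
  have \<delta>_rec: "\<delta> n = \<theta> * \<delta> (Suc n) + \<delta> (Suc n) ^ q" for n
  proof -
    have "z n = \<theta> * z (Suc n)"
      by (simp add: z_def)
    then have "\<delta> n = \<theta> * carlitz_exp q \<theta> (z (Suc n)) + carlitz_exp q \<theta> (z (Suc n)) ^ q -
        (\<theta> * w (Suc n) + w (Suc n) ^ q)"
      unfolding \<delta>_def by (simp only: carlitz_exp_theta w_Suc)
    then show ?thesis
      by (simp add: \<delta>_def frobenius_diff' algebra_simps)
  qed
  have inv_pow: "(\<lambda>n. inverse (real q ^ Suc n)) \<longlonglongrightarrow> 0"
    using LIMSEQ_Suc[OF LIMSEQ_power_zero[of "inverse (real q)"]] q_gt_1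
    by (simp add: power_inverse inverse_less_1_iff del: power_Suc)
  have "(\<lambda>n. N \<pi> * inverse (real q ^ Suc n)) \<longlonglongrightarrow> N \<pi> * 0"
    by (intro tendsto_intros inv_pow)
  then have "(\<lambda>n. N (z n)) \<longlonglongrightarrow> 0"
    by (simp add: N_z divide_inverse del: power_Suc)
  then have "\<forall>\<^sub>F n in sequentially. N (z n) < 1"
    by (rule order_tendstoD) simp
  then have upper: "\<forall>\<^sub>F n in sequentially.
      \<epsilon> n \<le> N \<pi> ^ 2 * inverse (real q ^ Suc n) + N (\<theta> ^ Suc n * w n - \<pi>)"
  proof eventually_elim
    case (elim n)
    have "N (\<delta> n) \<le> N (carlitz_exp q \<theta> (z n) - z n) + N (z n - w n)"
      using N_triangle[of "carlitz_exp q \<theta> (z n) - z n" "z n - w n"] by (simp add: \<delta>_def)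
    also have "\<dots> \<le> N (z n) ^ 2 + N (w n - z n)"
      using N_carlitz_exp_minus_le[of "z n"] elim N_diff_commute[of "z n" "w n"] by simp
    finally have "\<epsilon> n \<le> real q ^ Suc n * (N (z n) ^ 2 + N (w n - z n))"
      unfolding \<epsilon>_def by (intro mult_left_mono) auto
    also have "\<dots> = N \<pi> ^ 2 * inverse (real q ^ Suc n) + N (\<theta> ^ Suc n * (w n - z n))"
    proof -
      have "Q * ((p / Q) ^ 2 + d) = p ^ 2 * inverse Q + Q * d" if "Q \<noteq> 0" for Q p d :: real
        using that by (simp add: distrib_left power2_eq_square divide_inverse)
      from this[of "real q ^ Suc n"] show ?thesis
        using q_pos unfolding N_z N_mult N_power N_theta by simp
    qed
    also have "\<theta> ^ Suc n * (w n - z n) = \<theta> ^ Suc n * w n - \<pi>"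
      by (simp add: z_def right_diff_distrib del: power_Suc)
    finally show ?case .
  qed
  have "(\<lambda>n. N \<pi> ^ 2 * inverse (real q ^ Suc n) + N (\<theta> ^ Suc n * w n - \<pi>))
      \<longlonglongrightarrow> N \<pi> ^ 2 * 0 + 0"
    by (intro tendsto_add tendsto_mult tendsto_const inv_pow tower_tendsto_pi[unfolded tendsto_iff_N])
  then have \<epsilon>_lim: "\<epsilon> \<longlonglongrightarrow> 0"
    using upper by (intro tendsto_sandwich[OF _ upper tendsto_const]) (simp_all add: \<epsilon>_def)
  then have "\<forall>\<^sub>F n in sequentially. \<epsilon> n < 1"
    by (rule order_tendstoD) simp
  then obtain n0 where n0: "\<epsilon> n < 1" if "n \<ge> n0" for n
    by (auto simp: eventually_sequentially)
  have \<epsilon>_mono: "\<epsilon> n \<le> \<epsilon> (Suc n)" if "n \<ge> n0" for n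
  proof -
    have "1 * N (\<delta> (Suc n)) \<le> \<epsilon> (Suc n)"
      unfolding \<epsilon>_def using q_ge_2 by (intro mult_right_mono one_le_power) auto
    then have "N (\<delta> (Suc n)) \<le> 1"
      using n0[of "Suc n"] that by simp
    then have "N (\<delta> (Suc n)) ^ q \<le> N (\<delta> (Suc n)) ^ 1"
      using q_pos by (intro power_decreasing) auto
    also have "\<dots> \<le> real q * N (\<delta> (Suc n))"
      using q_ge_2 mult_right_mono[of 1 "real q" "N (\<delta> (Suc n))"] by simp
    finally have "N (\<delta> n) \<le> real q * N (\<delta> (Suc n))"
      using N_add[of "\<theta> * \<delta> (Suc n)" "\<delta> (Suc n) ^ q"] \<delta>_rec[of n]
      by (simp add: N_mult N_power N_theta)
    then have "real q ^ Suc n * N (\<delta> n) \<le> real q ^ Suc n * (real q * N (\<delta> (Suc n)))"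
      by (intro mult_left_mono) auto
    then show ?thesis
      by (simp add: \<epsilon>_def mult_ac)
  qed
  have large: "\<delta> n = 0" if "n \<ge> n0" for n
  proof -
    have "\<epsilon> n \<le> \<epsilon> m" if "m \<ge> n" for m
      using that
    proof (induction m rule: dec_induct)
      case (step m)
      then show ?case
        using \<epsilon>_mono[of m] \<open>n \<ge> n0\<close> by simp
    qed simp
    then have "\<epsilon> n \<le> 0"
      using \<epsilon>_lim by (intro LIMSEQ_le_const[of \<epsilon>]) auto
    moreover have "0 < \<epsilon> n" if "\<delta> n \<noteq> 0"
      unfolding \<epsilon>_def using that q_pos by (intro mult_pos_pos zero_less_power) simp_all
    ultimately show ?thesis
      by fastforce
  qed
  have "\<delta> n = 0 \<Longrightarrow> \<delta> 0 = 0 \<and> (\<forall>m\<le>n. \<delta> m = 0)" for n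
  proof (induction n)
    case (Suc n)
    then have "\<delta> n = 0"
      using \<delta>_rec[of n] q_pos by (simp add: zero_power)
    then show ?case
      using Suc by (auto simp: le_Suc_eq)
  qed simp
  from this[of "max n0 i"] large[of "max n0 i"] have "\<delta> i = 0"
    by simp
  then show ?thesis
    by (simp add: \<delta>_def z_def)
qed

lemma carlitz_exp_pi_mult: "carlitz_exp q \<theta> (\<pi> * \<theta> ^ i) = 0"
proof (induction i)
  case 0
  have "carlitz_exp q \<theta> (\<theta> * (\<pi> / \<theta> ^ Suc 0)) = 0"
    by (simp only: carlitz_exp_theta carlitz_exp_pi_div theta_w_0)
  then show ?case
    by simp
next
  case (Suc i)
  have "carlitz_exp q \<theta> (\<theta> * (\<pi> * \<theta> ^ i)) = 0"
    using q_pos by (simp add: carlitz_exp_theta Suc zero_power)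
  then show ?case
    by (simp add: mult_ac)
qed

section \<open>Series with periodic coefficients\<close>

text \<open>
  For \<open>M > 0\<close> this is the sum of the geometric series \<open>(\<Sum>k. 1 / \<theta> ^ (j + k * M + 1))\<close>. It equals
  \<open>\<theta> ^ M / (\<theta> ^ (j + 1) * (\<theta> ^ M - 1))\<close>, so \<open>exp\<close> at \<open>\<pi>\<close> times it is a torsion point of the Carlitz
  module.
\<close>

definition torsion_arg :: "nat \<Rightarrow> nat \<Rightarrow> 'c" where
  "torsion_arg j M = 1 / (\<theta> ^ Suc j * (1 - 1 / \<theta> ^ M))"

text \<open>
  Summing the tower along an arithmetic progression sums a geometric series inside the exponential.
\<close>

lemma tower_progression_sums:
  assumes "0 < M"
  shows "(\<lambda>k. w (j + k * M)) sums carlitz_exp q \<theta> (\<pi> * torsion_arg j M)"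
proof -
  define x where "x = 1 / \<theta> ^ M"
  have "1 < real q ^ M"
    using assms q_ge_2 by (intro one_less_power) auto
  then have "N x < 1"
    unfolding x_def N_divide N_power N_theta N_1 using q_pos by (subst divide_less_eq_1_pos) auto
  from sums_mult_left_N[OF sums_geometric_N[OF this], of "\<pi> / \<theta> ^ Suc j"]
  have "(\<lambda>n. \<Sum>k<n. \<pi> / \<theta> ^ Suc j * x ^ k) \<longlonglongrightarrow> \<pi> * torsion_arg j M"
    by (simp add: sums_def torsion_arg_def x_def)
  from carlitz_exp_tendsto[OF this]
  have "(\<lambda>k. carlitz_exp q \<theta> (\<pi> / \<theta> ^ Suc j * x ^ k)) sums carlitz_exp q \<theta> (\<pi> * torsion_arg j M)"
    by (simp add: sums_def carlitz_exp_sum)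
  moreover have "\<pi> / \<theta> ^ Suc j * x ^ k = \<pi> / \<theta> ^ Suc (j + k * M)" for k
    by (simp add: x_def power_add power_divide mult.commute flip: power_mult)
  ultimately show ?thesis
    by (simp only: carlitz_exp_pi_div)
qed

lemma N_w_tendsto_0: "(\<lambda>i. N (w (i + n))) \<longlonglongrightarrow> 0"
proof -
  have "(\<lambda>i. N r * (1 / real q) ^ i) \<longlonglongrightarrow> N r * 0"
    using q_ge_2 by (intro tendsto_intros LIMSEQ_power_zero) auto
  then have "(\<lambda>i. N (w i)) \<longlonglongrightarrow> 0"
    by (simp add: N_w power_divide)
  then show ?thesis
    by (rule LIMSEQ_ignore_initial_segment)
qed

lemma tower_series_sums:
  assumes "\<And>i. N (c i) \<le> 1"
  shows "(\<lambda>i. c i * w (i + n)) sums (\<Sum>i. c i * w (i + n))"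
proof (rule sums_suminf_N)
  have "N (c i * w (i + n)) \<le> N (w (i + n))" for i
    using assms mult_right_mono[of "N (c i)" 1 "N (w (i + n))"] by (simp add: N_mult)
  then show "(\<lambda>i. N (c i * w (i + n))) \<longlonglongrightarrow> 0"
    by (intro tendsto_sandwich[OF _ _ tendsto_const N_w_tendsto_0[of n]]) auto
qed

text \<open>
  Grouping the convergent series into blocks of length \<open>M\<close> splits it into \<open>M\<close> progressions.
\<close>

lemma periodic_tower_sums:
  assumes M: "0 < M"
    and period: "\<And>i. c (i + M) = c i"
    and bound: "\<And>i. N (c i) \<le> 1"
  shows "(\<lambda>i. c i * w (i + n)) sums (\<Sum>j<M. c j * carlitz_exp q \<theta> (\<pi> * torsion_arg (n + j) M))"
proof -
  define f where "f = (\<lambda>i. c i * w (i + n))"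
  define S where "S = (\<Sum>j<M. c j * carlitz_exp q \<theta> (\<pi> * torsion_arg (n + j) M))"
  have c_mult: "c (j + k * M) = c j" for j k
  proof (induction k)
    case (Suc k)
    then show ?case
      using period[of "j + k * M"] by (simp add: ac_simps)
  qed simp
  have f_sums: "f sums suminf f"
    unfolding f_def by (rule tower_series_sums[OF bound])
  have "(\<lambda>k. \<Sum>j<M. c j * w (n + j + k * M)) sums S"
    unfolding S_def by (intro sums_sum_N sums_mult_left_N tower_progression_sums M)
  moreover have "(\<Sum>j<M. c j * w (n + j + k * M)) = sum f {k * M..<k * M + M}" for k
  proof -
    have "sum f {k * M..<k * M + M} = (\<Sum>j<M. f (j + k * M))"
      using sum.shift_bounds_nat_ivl[of f 0 "k * M" M] by (simp add: lessThan_atLeast0 add.commute)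
    moreover have "(\<Sum>j<M. f (j + k * M)) = (\<Sum>j<M. c j * w (n + j + k * M))"
      unfolding f_def c_mult by (simp add: ac_simps)
    ultimately show ?thesis
      by simp
  qed
  ultimately have "(\<lambda>n. \<Sum>k<n. sum f {k * M..<k * M + M}) \<longlonglongrightarrow> S"
    by (simp add: sums_def)
  then have "(\<lambda>n. sum f {..<n * M}) \<longlonglongrightarrow> S"
    by (simp add: sum.nat_group)
  moreover have "(\<lambda>n. sum f {..<n * M}) \<longlonglongrightarrow> suminf f"
    using LIMSEQ_subseq_LIMSEQ[OF f_sums[unfolded sums_def], of "\<lambda>n. n * M"] M
    by (simp add: strict_mono_def o_def)
  ultimately have "S = suminf f"
    by (rule LIMSEQ_unique)
  with f_sums have "f sums S"
    by simp
  then show ?thesis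
    by (simp only: f_def S_def)
qed

abbreviation at_value :: "nat \<Rightarrow> 'c \<Rightarrow> 'c" where
  "at_value n \<zeta> \<equiv> fps_value (divided_deriv n (anderson_thakur_fps q \<theta> r)) \<zeta>"

lemma at_value_sums:
  assumes "N \<zeta> \<le> 1"
  shows "(\<lambda>m. of_nat ((m + n) choose n) * \<zeta> ^ m * w (m + n)) sums at_value n \<zeta>"
proof -
  have "N (of_nat ((m + n) choose n) * \<zeta> ^ m) \<le> 1" for m
    unfolding N_mult N_power by (intro mult_le_one power_le_one N_of_nat_le_1 assms) auto
  from tower_series_sums[OF this] show ?thesis
    by (simp add: fps_value_def divided_deriv_def anderson_thakur_fps_eq mult_ac)
qed

lemma at_value_0: "at_value n 0 = w n"
proof -
  have "at_value n 0 = (\<Sum>m. if m = 0 then w n else 0)"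
    unfolding fps_value_def
    by (rule suminf_cong) (simp add: divided_deriv_def anderson_thakur_fps_eq)
  also have "(\<lambda>m. if m = 0 then w n else 0) sums w n"
    unfolding sums_def
    by (intro tendsto_eventually eventually_sequentiallyI[of 1]) (simp add: sum.delta)
  then have "(\<Sum>m. if m = 0 then w n else 0) = w n"
    by (rule sums_unique[symmetric])
  finally show ?thesis .
qed

lemma binomial_tower_sums:
  assumes "N \<zeta> \<le> 1"
  shows "(\<lambda>i. of_nat (i choose n) * \<zeta> ^ i * w i) sums (\<zeta> ^ n * at_value n \<zeta>)"
proof (rule sums_shift_zero_N[where n = n])
  show "(\<lambda>m. of_nat ((m + n) choose n) * \<zeta> ^ (m + n) * w (m + n)) sums (\<zeta> ^ n * at_value n \<zeta>)"
    using sums_mult_left_N[OF at_value_sums[OF assms], of "\<zeta> ^ n"]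
    by (simp add: power_add mult_ac)
qed (simp add: binomial_eq_0)

end

section \<open>Finite fields, binomial coefficients and roots of unity\<close>

lemma power_card_eq_same:
  fixes x :: "'a::{field,finite}"
  shows "x ^ CARD('a) = x"
proof (cases "x = 0")
  case False
  have "prod ((*) x) (UNIV - {0}) = \<Prod>(UNIV - {0})"
    using False by (intro prod.reindex_bij_witness[of _ "\<lambda>y. y / x" "\<lambda>y. x * y"]) auto
  then have "x ^ (CARD('a) - 1) = 1"
    by (simp add: prod.distrib card_Diff_singleton)
  then have "x * x ^ (CARD('a) - 1) = x"
    by simp
  then show ?thesis
    by (simp flip: power_Suc)
qed simp

text \<open>
  The polynomial \<open>(1 + x) ^ q - x ^ q - 1\<close> vanishes on a field with \<open>q\<close> elements and has degree
  less than \<open>q\<close>, so all its coefficients are zero. This is the reason why the \<open>q\<close>-th power map is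
  additive in every ring of the same characteristic.
\<close>

lemma CHAR_dvd_card_choose:
  assumes "0 < k" "k < CARD('a::{field,finite})"
  shows "CHAR('a) dvd (CARD('a) choose k)"
proof -
  define Q where "Q = CARD('a)"
  have "[:1, 1:] ^ Q = Polynomial.monom 1 Q + (1 :: 'a poly)"
  proof (rule poly_eqI_degree_lead_coeff[where n = Q and A = UNIV])
    show "Polynomial.coeff ([:1, 1:] ^ Q) Q = Polynomial.coeff (Polynomial.monom 1 Q + (1 :: 'a poly)) Q"
      using assms by (simp add: coeff_linear_poly_power Q_def)
    show "Polynomial.degree ([:1, 1:] ^ Q :: 'a poly) \<le> Q"
      using degree_power_le[of "[:1, 1 :: 'a:]" Q] by simp
    show "Polynomial.degree (Polynomial.monom 1 Q + (1 :: 'a poly)) \<le> Q"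
      by (intro degree_add_le degree_monom_le) simp
    show "poly ([:1, 1:] ^ Q) z = poly (Polynomial.monom 1 Q + 1) z" for z :: 'a
      by (simp add: poly_monom power_card_eq_same Q_def add.commute)
  qed (simp add: Q_def)
  from arg_cong[OF this, of "\<lambda>p. Polynomial.coeff p k"] assms
  have "of_nat (Q choose k) = (0 :: 'a)"
    by (simp add: coeff_linear_poly_power Q_def)
  then show ?thesis
    by (simp add: of_nat_eq_0_iff_char_dvd Q_def)
qed

lemma power_card_add:
  fixes x y :: "'b::comm_ring_1"
  assumes "CHAR('b) = CHAR('a::{field,finite})"
  shows "(x + y) ^ CARD('a) = x ^ CARD('a) + y ^ CARD('a)"
proof -
  define Q where "Q = CARD('a)"
  have "(x + y) ^ Q = (\<Sum>k\<le>Q. of_nat (Q choose k) * x ^ k * y ^ (Q - k))"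
    by (rule binomial_ring)
  also have "\<dots> = (\<Sum>k\<in>{0, Q}. of_nat (Q choose k) * x ^ k * y ^ (Q - k))"
  proof (intro sum.mono_neutral_right ballI)
    fix k assume "k \<in> {..Q} - {0, Q}"
    then have "of_nat (Q choose k) = (0 :: 'b)"
      using CHAR_dvd_card_choose[of k, where ?'a = 'a] assms
      by (simp add: Q_def of_nat_eq_0_iff_char_dvd)
    then show "of_nat (Q choose k) * x ^ k * y ^ (Q - k) = 0"
      by simp
  qed auto
  also have "\<dots> = x ^ Q + y ^ Q"
    by (simp add: Q_def add.commute)
  finally show ?thesis
    by (simp add: Q_def)
qed

text \<open>
  Compare the coefficients of \<open>x ^ n\<close> in \<open>(1 + x) ^ (i + p ^ s) = (1 + x) ^ i * (1 + x ^ (p ^ s))\<close>.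
\<close>

lemma of_nat_choose_add_prime_power:
  assumes "Factorial_Ring.prime CHAR('b::field)" and n: "n < CHAR('b) ^ s"
  shows "of_nat ((i + CHAR('b) ^ s) choose n) = (of_nat (i choose n) :: 'b)"
proof -
  define P where "P = CHAR('b) ^ s"
  have coeff: "Polynomial.coeff ([:1, 1:] ^ m) n = (of_nat (m choose n) :: 'b)" for m
  proof (cases "n \<le> m")
    case False
    then have "Polynomial.degree ([:1, 1 :: 'b:] ^ m) < n"
      using degree_power_le[of "[:1, 1 :: 'b:]" m] by simp
    then show ?thesis
      using False by (simp add: coeff_eq_0 binomial_eq_0)
  qed (simp add: coeff_linear_poly_power)
  have "[:1, 1 :: 'b:] ^ P = (1 + [:0, 1:]) ^ P"
    by (simp add: one_pCons)
  also have "\<dots> = 1 + [:0, 1:] ^ P"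
    using assms(1) by (subst freshmans_dream'[where n = s]) (simp_all add: P_def)
  also have "[:0, 1 :: 'b:] ^ P = Polynomial.monom 1 P"
    by (simp add: monom_altdef)
  finally have "[:1, 1 :: 'b:] ^ (i + P) = [:1, 1:] ^ i + Polynomial.monom 1 P * [:1, 1:] ^ i"
    by (simp add: power_add algebra_simps)
  from arg_cong[OF this, of "\<lambda>p. Polynomial.coeff p n"] show ?thesis
    using n by (simp only: coeff coeff_add coeff_monom_mult P_def) simp
qed

lemma of_nat_choose_add_mult_prime_power:
  assumes "Factorial_Ring.prime CHAR('b::field)" and "n < CHAR('b) ^ s"
  shows "of_nat ((i + k * CHAR('b) ^ s) choose n) = (of_nat (i choose n) :: 'b)"
proof (induction k)
  case (Suc k)
  then show ?case
    using of_nat_choose_add_prime_power[OF assms, of "i + k * CHAR('b) ^ s"]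
    by (simp add: ac_simps)
qed simp

lemma of_nat_choose_prime_power_minus_1:
  fixes s :: nat
  assumes p: "Factorial_Ring.prime CHAR('b::field)"
  defines "P \<equiv> CHAR('b) ^ s"
  shows "of_nat (i choose (P - 1)) = (if i mod P = P - 1 then 1 else 0 :: 'b)"
proof -
  have P: "0 < P"
    using p by (simp add: P_def prime_gt_0_nat)
  from of_nat_choose_add_mult_prime_power[OF p, of "P - 1" s "i mod P" "i div P"]
  have "of_nat (i choose (P - 1)) = (of_nat ((i mod P) choose (P - 1)) :: 'b)"
    using P by (simp add: P_def mult.commute)
  moreover have "i mod P < P"
    using P by simp
  ultimately show ?thesis
    by (cases "i mod P = P - 1") (auto simp: binomial_eq_0)
qed

text \<open>
  The binomial coefficient \<open>(i + a choose P - 1)\<close>, where \<open>P = p ^ s\<close> and \<open>a = P - 1 - j mod P\<close>, is the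
  indicator of \<open>i \<equiv> j\<close> modulo \<open>P\<close> in characteristic \<open>p\<close>, and the Vandermonde convolution expands it in
  the functions \<open>i \<mapsto> (i choose n)\<close>.
\<close>

lemma prime_power_residue_indicator:
  fixes s :: nat
  assumes p: "Factorial_Ring.prime CHAR('b::field)"
  defines "P \<equiv> CHAR('b) ^ s"
  shows "(\<Sum>n<P. of_nat (i choose n) * of_nat ((P - 1 - j mod P) choose (P - 1 - n))) =
    (if i mod P = j mod P then 1 else 0 :: 'b)"
proof -
  define a where "a = P - 1 - j mod P"
  have P: "0 < P"
    using p by (simp add: P_def prime_gt_0_nat)
  then have j: "j mod P < P"
    by simp
  have "{..<P} = {..P - 1}"
    using P by auto
  then have "(\<Sum>n<P. of_nat (i choose n) * of_nat (a choose (P - 1 - n))) =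
      (of_nat ((i + a) choose (P - 1)) :: 'b)"
    by (simp only: vandermonde[of i a "P - 1", symmetric] of_nat_sum of_nat_mult)
  also have "\<dots> = (if (i + a) mod P = P - 1 then 1 else 0)"
    unfolding P_def by (rule of_nat_choose_prime_power_minus_1[OF p])
  also have "(i + a) mod P = P - 1 \<longleftrightarrow> i mod P = j mod P"
  proof -
    have "(j mod P + a) mod P = P - 1"
      using j by (simp add: a_def)
    then have "(i + a) mod P = P - 1 \<longleftrightarrow> [i + a = j mod P + a] (mod P)"
      by (simp add: cong_def)
    then show ?thesis
      by (simp add: cong_add_rcancel_nat) (simp add: cong_def)
  qed
  finally show ?thesis
    by (simp add: a_def)
qed

lemma finite_roots_of_unity:
  "0 < m \<Longrightarrow> finite {z :: 'b::field. z ^ m = 1}"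
  using poly_roots_finite[of "Polynomial.monom (1 :: 'b) m - 1"]
  by (auto simp: poly_monom monom_eq_1_iff)

lemma card_roots_of_unity_le:
  assumes "0 < m"
  shows "card {z :: 'b::field. z ^ m = 1} \<le> m"
  using card_poly_roots_bound[of "Polynomial.monom (1 :: 'b) m - 1"] assms
    degree_diff_le[of "Polynomial.monom (1 :: 'b) m" m 1]
  by (simp add: poly_monom monom_eq_1_iff degree_monom_le)

text \<open>
  If \<open>m\<close> does not divide \<open>k\<close>, there are too few \<open>(k mod m)\<close>-th roots of unity to contain all \<open>m\<close>-th
  ones. Multiplication by an \<open>m\<close>-th root of unity \<open>x\<close> with \<open>x ^ k \<noteq> 1\<close> permutes the summation range and
  multiplies the sum by \<open>x ^ k\<close>.
\<close>

lemma sum_roots_of_unity: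
  fixes m k :: nat
  assumes m: "0 < m" and card: "card {z :: 'b::field. z ^ m = 1} = m"
  shows "(\<Sum>z | z ^ m = 1. z ^ k) = (if m dvd k then of_nat m else 0 :: 'b)"
proof (cases "m dvd k")
  case True
  then have "(\<Sum>z | z ^ m = 1. z ^ k) = (\<Sum>z | z ^ m = (1 :: 'b). 1 :: 'b)"
    by (intro sum.cong) (auto elim!: dvdE simp: power_mult)
  then show ?thesis
    using True card by simp
next
  case False
  define l where "l = k mod m"
  have l: "0 < l" "l < m"
    using False m by (auto simp: l_def dvd_eq_mod_eq_0)
  have "card {z :: 'b. z ^ l = 1} \<le> l"
    by (rule card_roots_of_unity_le[OF l(1)])
  then have "\<not> {z :: 'b. z ^ m = 1} \<subseteq> {z. z ^ l = 1}"
    using card_mono[OF finite_roots_of_unity[OF l(1), where ?'b = 'b], of "{z. z ^ m = 1}"] card l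
    by auto
  then obtain x :: 'b where x: "x ^ m = 1" "x ^ l \<noteq> 1"
    by blast
  have "x ^ k = x ^ l"
    using x(1) mod_mult_div_eq[of k m] by (metis l_def mult_1_right power_add power_mult power_one)
  with x m have "x ^ k \<noteq> 1" "x \<noteq> 0"
    by (auto simp: zero_power)
  have "x ^ k * (\<Sum>z | z ^ m = 1. z ^ k) = (\<Sum>z | z ^ m = 1. (x * z) ^ k)"
    by (simp add: sum_distrib_left power_mult_distrib)
  also have "\<dots> = (\<Sum>z | z ^ m = 1. z ^ k)"
    using x \<open>x \<noteq> 0\<close>
    by (intro sum.reindex_bij_witness[of _ "\<lambda>z. z / x" "\<lambda>z. x * z"])
      (auto simp: power_mult_distrib power_divide)
  finally show ?thesis
    using \<open>x ^ k \<noteq> 1\<close> False by simp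
qed

text \<open>
  A double root of \<open>x ^ m - 1\<close> would be a root of the derivative \<open>m * x ^ (m - 1)\<close>, hence \<open>0\<close>.
\<close>

lemma card_roots_of_unity:
  assumes "0 < m" and m: "of_nat m \<noteq> (0 :: 'b::alg_closed_field)"
  shows "card {z :: 'b. z ^ m = 1} = m"
proof -
  define f where "f = Polynomial.monom (1 :: 'b) m - 1"
  have deg: "Polynomial.degree f = m"
    unfolding f_def using assms(1)
    by (subst diff_conv_add_uminus, subst degree_add_eq_left) (simp_all add: degree_monom_eq)
  then have "f \<noteq> 0"
    using assms(1) by auto
  have roots: "set_mset (proots f) = {z. z ^ m = 1}"
    using \<open>f \<noteq> 0\<close> by (simp add: f_def poly_monom)
  have "count (proots f) a = 1" if "a \<in> set_mset (proots f)" for a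
  proof -
    have a: "a ^ m = 1"
      using that by (simp add: roots)
    have "\<not> [:- a, 1:] ^ 2 dvd f"
    proof
      define l where "l = [:- a, 1:]"
      assume "[:- a, 1:] ^ 2 dvd f"
      then obtain g where "f = l ^ 2 * g"
        unfolding l_def by (rule dvdE)
      moreover have "poly l a = 0"
        by (simp add: l_def)
      ultimately have "poly (pderiv f) a = 0"
        by (simp add: power2_eq_square pderiv_mult)
      then have "a ^ (m - 1) = 0"
        using m by (simp add: f_def pderiv_diff pderiv_monom poly_monom)
      then show False
        using a assms(1) by (auto simp: zero_power)
    qed
    then have "count (proots f) a \<le> 1"
      using \<open>f \<noteq> 0\<close> by (simp add: order_divides)
    moreover have "0 < count (proots f) a"
      using that by simp
    ultimately show ?thesis
      by linarith
  qed
  then have size_card: "size (proots f) = card {z :: 'b. z ^ m = 1}"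
    by (simp add: size_multiset_overloaded_eq flip: roots)
  obtain A where A: "size A = Polynomial.degree f"
      "f = Polynomial.smult (Polynomial.lead_coeff f) (\<Prod>x\<in>#A. [:- x, 1:])"
    using alg_closed_imp_factorization[OF \<open>f \<noteq> 0\<close>] by blast
  have "proots f = proots (\<Prod>x\<in>#A. [:- x, 1:])"
    by (subst A(2)) (simp add: \<open>f \<noteq> 0\<close>)
  also have "\<dots> = A"
  proof (induction A)
    case (add x A)
    have "(\<Prod>x\<in>#A. [:- x, 1 :: 'b:]) \<noteq> 0"
      by (auto simp: prod_mset_zero_iff)
    with add show ?case
      by (simp add: proots_mult del: mult_pCons_left)
  qed simp
  finally have "size (proots f) = m"
    using A(1) deg by simp
  with size_card show ?thesis
    by simp
qed

section \<open>Polynomials over a finite field\<close>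

lemma finite_degree_le: "finite {f :: 'a::{zero,finite} poly. Polynomial.degree f \<le> n}"
proof (rule finite_subset)
  show "{f :: 'a poly. Polynomial.degree f \<le> n} \<subseteq> Poly ` {xs. set xs \<subseteq> UNIV \<and> length xs \<le> Suc n}"
  proof
    fix f :: "'a poly"
    assume "f \<in> {f. Polynomial.degree f \<le> n}"
    then have "length (coeffs f) \<le> Suc n"
      by (cases "f = 0") (simp_all add: length_coeffs_degree)
    then show "f \<in> Poly ` {xs. set xs \<subseteq> UNIV \<and> length xs \<le> Suc n}"
      by (intro image_eqI[of _ _ "coeffs f"]) auto
  qed
  show "finite (Poly ` {xs :: 'a list. set xs \<subseteq> UNIV \<and> length xs \<le> Suc n})"
    by (intro finite_imageI finite_lists_length_le) simp
qed

text \<open>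
  The powers of the variable have only finitely many residues modulo \<open>b\<close>, so two of them agree.
\<close>

lemma dvd_monom_minus_1:
  fixes b :: "'a::{field,finite} poly"
  assumes "b \<noteq> 0"
  obtains n m where "0 < m" "b dvd Polynomial.monom 1 n * (Polynomial.monom 1 m - 1)"
proof -
  define res where "res i = Polynomial.monom 1 i mod b" for i
  have "Polynomial.degree (res i) \<le> Polynomial.degree b" for i
    using degree_mod_less[OF assms, of "Polynomial.monom 1 i"] unfolding res_def by auto
  then have "finite (range res)"
    by (intro finite_subset[OF _ finite_degree_le[of "Polynomial.degree b"]]) auto
  then have "\<not> inj res"
    using finite_imageD infinite_UNIV_nat by blast
  then obtain i j where "i < j" "res i = res j"
    unfolding inj_def by (metis nat_neq_iff)
  then have "b dvd Polynomial.monom 1 j - Polynomial.monom 1 i"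
    by (simp add: res_def mod_eq_dvd_iff dvd_diff_commute)
  also have "Polynomial.monom 1 j - Polynomial.monom 1 i =
      Polynomial.monom (1 :: 'a) i * (Polynomial.monom 1 (j - i) - 1)"
    using \<open>i < j\<close> by (simp add: right_diff_distrib mult_monom)
  finally show thesis
    using that[of "j - i" i] \<open>i < j\<close> by simp
qed

locale field_embedding =
  fixes \<kappa> :: "'a::field \<Rightarrow> 'c::field"
  assumes \<kappa>_1 [simp]: "\<kappa> 1 = 1"
    and \<kappa>_add [simp]: "\<kappa> (a + b) = \<kappa> a + \<kappa> b"
    and \<kappa>_mult [simp]: "\<kappa> (a * b) = \<kappa> a * \<kappa> b"
begin

lemma \<kappa>_0 [simp]: "\<kappa> 0 = 0"
  using \<kappa>_add[of 0 0] by (metis add.right_neutral add_left_cancel)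

lemma \<kappa>_minus [simp]: "\<kappa> (- a) = - \<kappa> a"
  using \<kappa>_add[of "- a" a] by (simp add: eq_neg_iff_add_eq_0)

lemma \<kappa>_eq_0_iff [simp]: "\<kappa> a = 0 \<longleftrightarrow> a = 0"
proof
  assume "\<kappa> a = 0"
  then show "a = 0"
    using \<kappa>_mult[of a "inverse a"] by (cases "a = 0") auto
qed simp

lemma inj_\<kappa>: "inj \<kappa>"
proof (rule injI)
  fix a b assume "\<kappa> a = \<kappa> b"
  then have "\<kappa> (a + - b) = 0"
    by (simp only: \<kappa>_add \<kappa>_minus) simp
  then show "a = b"
    by (simp only: \<kappa>_eq_0_iff) simp
qed

lemma \<kappa>_power [simp]: "\<kappa> (a ^ n) = \<kappa> a ^ n"
  by (induction n) simp_all

lemma \<kappa>_of_nat [simp]: "\<kappa> (of_nat n) = of_nat n"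
  by (induction n) simp_all

lemma CHAR_eq: "CHAR('c) = CHAR('a)"
proof (rule CHAR_eqI)
  show "of_nat CHAR('a) = (0 :: 'c)"
    by (simp flip: \<kappa>_of_nat)
  fix n assume "of_nat n = (0 :: 'c)"
  then have "of_nat n = (0 :: 'a)"
    by (simp flip: \<kappa>_of_nat)
  then show "CHAR('a) dvd n"
    by (simp add: of_nat_eq_0_iff_char_dvd)
qed

definition ev :: "'a poly \<Rightarrow> 'c \<Rightarrow> 'c" where
  "ev f x = poly (map_poly \<kappa> f) x"

lemma ev_0 [simp]: "ev 0 x = 0"
  and ev_1 [simp]: "ev 1 x = 1"
  and ev_pCons [simp]: "ev (pCons a f) x = \<kappa> a + x * ev f x"
  and ev_monom [simp]: "ev (Polynomial.monom a n) x = \<kappa> a * x ^ n"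
  by (simp_all add: ev_def map_poly_pCons map_poly_monom poly_monom)

lemma ev_add [simp]: "ev (f + g) x = ev f x + ev g x"
  by (induction f g rule: poly_induct2) (simp_all add: algebra_simps)

lemma ev_smult [simp]: "ev (Polynomial.smult a f) x = \<kappa> a * ev f x"
  by (induction f) (simp_all add: algebra_simps)

lemma ev_mult [simp]: "ev (f * g) x = ev f x * ev g x"
  by (induction f) (simp_all add: algebra_simps)

lemma ev_minus [simp]: "ev (- f) x = - ev f x"
  using ev_add[of "- f" f x] by (simp add: eq_neg_iff_add_eq_0)

lemma ev_diff [simp]: "ev (f - g) x = ev f x - ev g x"
  using ev_add[of f "- g" x] by simp

lemma algebraic_over_range_\<kappa>:
  assumes "algebraic_over (range \<kappa>) x"
  obtains f where "f \<noteq> 0" "ev f x = 0"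
proof -
  obtain g where g: "g \<noteq> 0" "\<And>i. Polynomial.coeff g i \<in> range \<kappa>" "poly g x = 0"
    using assms by (auto simp: algebraic_over_def)
  define f where "f = map_poly (inv_into UNIV \<kappa>) g"
  have "inv_into UNIV \<kappa> 0 = 0"
    using inv_f_f[OF inj_\<kappa>, of 0] by simp
  then have "map_poly \<kappa> f = map_poly (\<kappa> \<circ> inv_into UNIV \<kappa>) g"
    unfolding f_def by (intro map_poly_map_poly) simp_all
  also have "\<dots> = g"
    using g(2) by (intro map_poly_idI) (auto simp: coeffs_def intro!: f_inv_into_f split: if_splits)
  finally have f: "map_poly \<kappa> f = g" .
  then have "f \<noteq> 0"
    using g(1) by auto
  then show thesis
    using g(3) f that[of f] by (simp add: ev_def)
qed

end

section \<open>Subfields\<close>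

lemma is_subfield_hull: "is_subfield (is_subfield hull S)"
  by (rule hull_in) (auto simp: is_subfield_def)

context
  fixes F :: "'c::field set"
  assumes F: "is_subfield F"
begin

lemma subfield_0: "0 \<in> F" and subfield_1: "1 \<in> F"
  and subfield_add: "x \<in> F \<Longrightarrow> y \<in> F \<Longrightarrow> x + y \<in> F"
  and subfield_mult: "x \<in> F \<Longrightarrow> y \<in> F \<Longrightarrow> x * y \<in> F"
  and subfield_minus: "x \<in> F \<Longrightarrow> - x \<in> F"
  and subfield_inverse: "x \<in> F \<Longrightarrow> inverse x \<in> F"
  using F by (auto simp: is_subfield_def)

lemma subfield_diff: "x \<in> F \<Longrightarrow> y \<in> F \<Longrightarrow> x - y \<in> F"
  using subfield_add[of x "- y"] subfield_minus[of y] by simp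

lemma subfield_divide: "x \<in> F \<Longrightarrow> y \<in> F \<Longrightarrow> x / y \<in> F"
  by (simp add: divide_inverse subfield_mult subfield_inverse)

lemma subfield_power: "x \<in> F \<Longrightarrow> x ^ n \<in> F"
  by (induction n) (simp_all add: subfield_1 subfield_mult)

lemma subfield_of_nat: "of_nat n \<in> F"
  by (induction n) (simp_all add: subfield_0 subfield_1 subfield_add)

lemma subfield_sum: "(\<And>i. i \<in> I \<Longrightarrow> f i \<in> F) \<Longrightarrow> sum f I \<in> F"
  by (induction I rule: infinite_finite_induct) (simp_all add: subfield_0 subfield_add)

end

section \<open>Values of divided derivatives and values of the exponential\<close>

locale carlitz_over_finite_field = carlitz N q \<theta> r + field_embedding \<kappa>
  for N :: "'c::{field,complete_space} \<Rightarrow> real" and q \<theta> r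
    and \<kappa> :: "'a::{field,finite} \<Rightarrow> 'c" +
  assumes q_eq: "q = CARD('a)"
    and enough_roots_of_unity:
      "\<lbrakk>0 < m; of_nat m \<noteq> (0 :: 'c)\<rbrakk> \<Longrightarrow> card {z :: 'c. z ^ m = 1} = m"
begin

lemma prime_CHAR: "Factorial_Ring.prime CHAR('c)"
  unfolding CHAR_eq by (intro prime_CHAR_semidom finite_imp_CHAR_pos) simp

lemma \<kappa>_power_q: "\<kappa> a ^ q = \<kappa> a"
  by (simp add: q_eq power_card_eq_same flip: \<kappa>_power)

lemma theta_power_neq_1: "0 < m \<Longrightarrow> \<theta> ^ m \<noteq> 1"
  using one_less_power[OF q_gt_1, of m] N_theta N_power[of \<theta> m] by auto

text \<open>
  A polynomial over the finite field that vanishes at \<open>x\<close> divides some \<open>X ^ n * (X ^ m - 1)\<close>.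
\<close>

lemma algebraic_imp_root_of_unity:
  assumes "algebraic_over (range \<kappa>) x" and "x \<noteq> 0"
  obtains m where "0 < m" "x ^ m = 1"
proof -
  obtain f where f: "f \<noteq> 0" "ev f x = 0"
    using algebraic_over_range_\<kappa>[OF assms(1)] .
  obtain n m where m: "0 < m" "f dvd Polynomial.monom 1 n * (Polynomial.monom 1 m - 1)"
    using dvd_monom_minus_1[OF f(1)] .
  then obtain g where "Polynomial.monom 1 n * (Polynomial.monom 1 m - 1) = f * g"
    by (elim dvdE)
  from arg_cong[OF this, of "\<lambda>p. ev p x"] f(2) have "x ^ n * (x ^ m - 1) = 0"
    by simp
  with assms(2) m(1) show thesis
    using that by simp
qed

lemma root_of_unity_imp_algebraic:
  assumes "0 < m" "x ^ m = 1"
  shows "algebraic_over (range \<kappa>) x"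
proof -
  define f where "f = map_poly \<kappa> (Polynomial.monom 1 m - 1)"
  have "Polynomial.coeff f i \<in> range \<kappa>" for i
    by (simp add: f_def coeff_map_poly)
  moreover have "f \<noteq> 0"
    using assms(1) by (simp add: f_def map_poly_eq_0_iff monom_eq_1_iff)
  moreover have "poly f x = 0"
    using assms(2) by (simp add: f_def flip: ev_def)
  ultimately show ?thesis
    unfolding algebraic_over_def by blast
qed

lemma algebraic_0: "algebraic_over (range \<kappa>) 0"
  unfolding algebraic_over_def
proof (intro exI conjI allI)
  show "Polynomial.coeff [:0, 1:] i \<in> range \<kappa>" for i
    by (auto simp: coeff_pCons intro: range_eqI[of _ _ 0] range_eqI[of _ _ 1] split: nat.split)
qed simp_all

lemma algebraic_range_\<kappa>: "algebraic_over (range \<kappa>) (\<kappa> a)"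
  using algebraic_0 root_of_unity_imp_algebraic[of "q - 1" "\<kappa> a"] \<kappa>_power_q[of a] q_ge_2
    power_Suc[of "\<kappa> a" "q - 1"]
  by (cases "\<kappa> a = 0") simp_all

lemma N_root_of_unity:
  assumes "0 < m" "x ^ m = 1"
  shows "N x = 1"
proof -
  have "N x ^ m = 1 ^ m"
    using assms(2) by (simp flip: N_power)
  then show ?thesis
    using assms(1) power_eq_iff_eq_base[of m "N x" 1] by simp
qed

text \<open>
  At a root of unity \<open>\<zeta>\<close> the coefficients \<open>(m + n choose n) * \<zeta> ^ m\<close> are periodic in characteristic
  \<open>p\<close>, so the series is a finite combination of exponential values.
\<close>

lemma at_value_in_subfield:
  assumes F: "is_subfield F" "{x. algebraic_over (range \<kappa>) x} \<subseteq> F"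
    and K: "is_subfield K" "\<theta> \<in> K"
    and exp_in: "\<And>\<rho>. \<rho> \<in> K \<Longrightarrow> carlitz_exp q \<theta> (\<pi> * \<rho>) \<in> F"
    and \<zeta>: "algebraic_over (range \<kappa>) \<zeta>"
  shows "at_value n \<zeta> \<in> F"
proof (cases "\<zeta> = 0")
  case True
  have "1 / \<theta> ^ Suc n \<in> K"
    using K by (intro subfield_divide subfield_1 subfield_power)
  from exp_in[OF this] show ?thesis
    using carlitz_exp_pi_div[of n] by (simp add: True at_value_0 del: power_Suc)
next
  case False
  then obtain m where m: "0 < m" "\<zeta> ^ m = 1"
    using algebraic_imp_root_of_unity[OF \<zeta>] by blast
  define P where "P = CHAR('c) ^ n"
  have "n < P"
    unfolding P_def using power_gt_expt[of "CHAR('c)" n] prime_gt_1_nat[OF prime_CHAR] by simp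
  define M where "M = m * P"
  define c where "c i = of_nat ((i + n) choose n) * \<zeta> ^ i" for i
  have "0 < M"
    using m(1) \<open>n < P\<close> by (simp add: M_def)
  have N_\<zeta>: "N \<zeta> = 1"
    using N_root_of_unity[OF m] .
  have "(\<lambda>i. c i * w (i + n)) sums (\<Sum>j<M. c j * carlitz_exp q \<theta> (\<pi> * torsion_arg (n + j) M))"
  proof (rule periodic_tower_sums[OF \<open>0 < M\<close>])
    show "c (i + M) = c i" for i
    proof -
      have "of_nat ((i + M + n) choose n) = (of_nat ((i + n) choose n) :: 'c)"
        using of_nat_choose_add_mult_prime_power[OF prime_CHAR \<open>n < P\<close>[unfolded P_def], of "i + n" m]
        by (simp add: M_def P_def ac_simps)
      then show ?thesis
        by (simp add: c_def power_add M_def power_mult m(2))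
    qed
    show "N (c i) \<le> 1" for i
      by (simp add: c_def N_mult N_power N_\<zeta> N_of_nat_le_1)
  qed
  moreover have "(\<lambda>i. c i * w (i + n)) sums at_value n \<zeta>"
    unfolding c_def using at_value_sums[of \<zeta> n] by (simp add: N_\<zeta>)
  ultimately have "at_value n \<zeta> = (\<Sum>j<M. c j * carlitz_exp q \<theta> (\<pi> * torsion_arg (n + j) M))"
    by (rule sums_unique2[symmetric])
  moreover have "\<zeta> \<in> F"
    using F(2) \<zeta> by auto
  then have "c j \<in> F" for j
    unfolding c_def using F(1) by (intro subfield_mult subfield_of_nat subfield_power)
  moreover have "torsion_arg j M \<in> K" for j
    unfolding torsion_arg_def using K
    by (intro subfield_divide subfield_mult subfield_diff subfield_power subfield_1)
  ultimately show ?thesis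
    using F(1) by (simp add: subfield_sum subfield_mult exp_in)
qed

text \<open>
  Conversely, the indicator of a residue class modulo \<open>m * p ^ s\<close> with \<open>m\<close> prime to \<open>p\<close> is a
  combination of the functions \<open>i \<mapsto> (i choose n) * \<zeta> ^ i\<close> with \<open>n < p ^ s\<close> and \<open>\<zeta> ^ m = 1\<close>.
\<close>

lemma residue_indicator:
  fixes m s j i :: nat
  assumes m: "0 < m" "\<not> CHAR('c) dvd m"
  defines "P \<equiv> CHAR('c) ^ s"
  shows "(if i mod (m * P) = j mod (m * P) then 1 else 0) =
    (\<Sum>n<P. \<Sum>z | z ^ m = (1 :: 'c). of_nat ((P - 1 - j mod P) choose (P - 1 - n)) * z ^ ((m - 1) * j) /
      of_nat m * (of_nat (i choose n) * z ^ i))"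
proof -
  define b where "b n = (of_nat ((P - 1 - j mod P) choose (P - 1 - n)) :: 'c)" for n
  have m_nonzero: "of_nat m \<noteq> (0 :: 'c)"
    using m(2) by (simp add: of_nat_eq_0_iff_char_dvd)
  \<comment> \<open>The exponent \<open>(m - 1) * j\<close> stands for \<open>- j\<close> modulo \<open>m\<close>.\<close>
  have "m dvd i + (m - 1) * j \<longleftrightarrow> i mod m = j mod m"
  proof -
    have "m dvd i + (m - 1) * j \<longleftrightarrow> [i + (m - 1) * j = j + (m - 1) * j] (mod m)"
    proof -
      have "j + (m - 1) * j = m * j"
        using m(1) by (cases m) simp_all
      then show ?thesis
        by (simp add: cong_def dvd_eq_mod_eq_0)
    qed
    then show ?thesis
      by (simp only: cong_add_rcancel_nat) (simp add: cong_def)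
  qed
  then have roots: "(\<Sum>z | z ^ m = (1 :: 'c). z ^ (i + (m - 1) * j)) =
      (if i mod m = j mod m then of_nat m else 0)"
    by (simp add: sum_roots_of_unity[OF m(1) enough_roots_of_unity[OF m(1) m_nonzero]])
  have "coprime m P"
    unfolding P_def using prime_imp_coprime[OF prime_CHAR m(2)] by (simp add: coprime_commute)
  then have crt: "i mod (m * P) = j mod (m * P) \<longleftrightarrow> i mod P = j mod P \<and> i mod m = j mod m"
    using coprime_cong_mult_nat[of i j m P] cong_modulus_mult_nat[of i j m P]
      cong_modulus_mult_nat[of i j P m]
    by (auto simp: cong_def mult.commute)
  have "(\<Sum>n<P. \<Sum>z | z ^ m = (1 :: 'c). b n * z ^ ((m - 1) * j) / of_nat m * (of_nat (i choose n) * z ^ i)) =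
      (\<Sum>n<P. \<Sum>z | z ^ m = (1 :: 'c). (of_nat (i choose n) * b n) * (z ^ (i + (m - 1) * j) / of_nat m))"
    by (simp add: power_add mult_ac)
  also have "\<dots> = (\<Sum>n<P. of_nat (i choose n) * b n) *
      ((\<Sum>z | z ^ m = (1 :: 'c). z ^ (i + (m - 1) * j)) / of_nat m)"
    by (simp only: sum_product sum_divide_distrib)
  also have "\<dots> = (if i mod (m * P) = j mod (m * P) then 1 else 0)"
    unfolding b_def P_def prime_power_residue_indicator[OF prime_CHAR] roots
    using m_nonzero crt by (simp add: P_def)
  finally show ?thesis
    by (simp add: b_def)
qed

lemma torsion_arg_split: "0 < M \<Longrightarrow> torsion_arg j M = 1 / \<theta> ^ Suc j + torsion_arg (j + M) M"
  using theta_power_neq_1[of M] by (simp add: torsion_arg_def power_add divide_simps)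

lemma rational_functions_quotients:
  assumes "\<rho> \<in> is_subfield hull (insert \<theta> (range \<kappa>))"
  obtains f g where "ev g \<theta> \<noteq> 0" "\<rho> = ev f \<theta> / ev g \<theta>"
proof -
  define K where "K = {ev f \<theta> / ev g \<theta> |f g. ev g \<theta> \<noteq> 0}"
  have K_I: "x \<in> K" if "x = ev f \<theta> / ev g \<theta>" "ev g \<theta> \<noteq> 0" for x f g
    using that by (auto simp: K_def)
  have "is_subfield K"
    unfolding is_subfield_def
  proof (intro conjI ballI)
    show "0 \<in> K" "1 \<in> K"
      by (rule K_I[of _ 0 1], simp_all) (rule K_I[of _ 1 1], simp_all)
    fix x assume "x \<in> K"
    then obtain f g where x: "x = ev f \<theta> / ev g \<theta>" "ev g \<theta> \<noteq> 0"
      by (auto simp: K_def)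
    show "- x \<in> K"
      using x by (intro K_I[of _ "- f" g]) simp_all
    show "inverse x \<in> K"
    proof (cases "ev f \<theta> = 0")
      case True
      then show ?thesis
        using x by (intro K_I[of _ 0 1]) simp_all
    next
      case False
      then show ?thesis
        using x by (intro K_I[of _ g f]) simp_all
    qed
    fix y assume "y \<in> K"
    then obtain f' g' where y: "y = ev f' \<theta> / ev g' \<theta>" "ev g' \<theta> \<noteq> 0"
      by (auto simp: K_def)
    show "x + y \<in> K"
      using x y by (intro K_I[of _ "f * g' + f' * g" "g * g'"]) (simp_all add: add_frac_eq)
    show "x * y \<in> K"
      using x y by (intro K_I[of _ "f * f'" "g * g'"]) simp_all
  qed
  moreover have "insert \<theta> (range \<kappa>) \<subseteq> K"
  proof safe
    show "\<theta> \<in> K"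
      by (rule K_I[of _ "Polynomial.monom 1 1" 1]) simp_all
    show "\<kappa> a \<in> K" for a
      by (rule K_I[of _ "[:a:]" 1]) simp_all
  qed
  ultimately have "\<rho> \<in> K"
    using assms hull_minimal by blast
  then show thesis
    using that by (auto simp: K_def)
qed

context
  fixes F :: "'c set"
  assumes F: "is_subfield F" "{x. algebraic_over (range \<kappa>) x} \<subseteq> F"
    and at_value_in: "\<And>\<zeta> n. algebraic_over (range \<kappa>) \<zeta> \<Longrightarrow> at_value n \<zeta> \<in> F"
begin

lemma tower_in: "w n \<in> F"
  using at_value_in[OF algebraic_0, of n] by (simp add: at_value_0)

text \<open>
  For \<open>j < M\<close> the value is the sum of \<open>w\<close> over a full residue class modulo \<open>M\<close>. Increasing \<open>j\<close> by \<open>M\<close>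
  removes one member of the class, which changes the value by \<open>w j\<close>.
\<close>

lemma exp_torsion_arg_in:
  fixes s :: nat
  assumes m: "0 < m" "\<not> CHAR('c) dvd m"
  defines "M \<equiv> m * CHAR('c) ^ s"
  shows "carlitz_exp q \<theta> (\<pi> * torsion_arg j M) \<in> F"
proof -
  define P where "P = CHAR('c) ^ s"
  have M: "0 < M" "M = m * P"
    using m(1) prime_gt_0_nat[OF prime_CHAR] by (auto simp: M_def P_def)
  have base: "carlitz_exp q \<theta> (\<pi> * torsion_arg j M) \<in> F" if "j < M" for j
  proof -
    \<comment> \<open>The same series of \<open>c i * w i\<close> is summed in two ways, by the expansion of the indicator
      \<open>c\<close> and as a series with periodic coefficients.\<close>
    define c where "c i = (if i mod M = j then 1 else 0 :: 'c)" for i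
    define b where "b n z = of_nat ((P - 1 - j mod P) choose (P - 1 - n)) * z ^ ((m - 1) * j) / of_nat m"
      for n and z :: 'c
    define S where "S = (\<Sum>n<P. \<Sum>z | z ^ m = 1. b n z * (z ^ n * at_value n z))"
    have c_eq: "c i = (\<Sum>n<P. \<Sum>z | z ^ m = 1. b n z * (of_nat (i choose n) * z ^ i))" for i
      using residue_indicator[OF m, of i s j] that by (simp add: c_def b_def P_def M)
    have "(\<lambda>i. \<Sum>n<P. \<Sum>z | z ^ m = 1. b n z * (of_nat (i choose n) * z ^ i * w i)) sums S"
      unfolding S_def
      by (intro sums_sum_N sums_mult_left_N binomial_tower_sums) (simp add: N_root_of_unity[OF m(1)])
    then have "(\<lambda>i. c i * w i) sums S"
      by (simp add: c_eq sum_distrib_right mult.assoc)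
    moreover have "(\<lambda>i. c i * w (i + 0)) sums (\<Sum>k<M. c k * carlitz_exp q \<theta> (\<pi> * torsion_arg (0 + k) M))"
      by (rule periodic_tower_sums[OF M(1)]) (simp_all add: c_def)
    ultimately have "S = (\<Sum>k<M. c k * carlitz_exp q \<theta> (\<pi> * torsion_arg k M))"
      using sums_unique2 by simp blast
    also have "\<dots> = (\<Sum>k<M. if k = j then carlitz_exp q \<theta> (\<pi> * torsion_arg k M) else 0)"
      by (intro sum.cong) (simp_all add: c_def)
    also have "\<dots> = carlitz_exp q \<theta> (\<pi> * torsion_arg j M)"
      using that by simp
    finally have "carlitz_exp q \<theta> (\<pi> * torsion_arg j M) = S" ..
    moreover have "b n z * (z ^ n * at_value n z) \<in> F" if "z ^ m = 1" for n z
    proof -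
      have "algebraic_over (range \<kappa>) z"
        using root_of_unity_imp_algebraic[OF m(1) that] .
      moreover from this have "z \<in> F"
        using F(2) by auto
      ultimately show ?thesis
        unfolding b_def using F(1)
        by (intro subfield_mult subfield_divide subfield_of_nat subfield_power at_value_in)
    qed
    ultimately show ?thesis
      using F(1) by (auto simp: S_def intro!: subfield_sum)
  qed
  have "carlitz_exp q \<theta> (\<pi> * torsion_arg (j + k * M) M) \<in> F" if "j < M" for j k
  proof (induction k)
    case (Suc k)
    define l where "l = j + k * M"
    have "\<pi> * torsion_arg (l + M) M = \<pi> * torsion_arg l M - \<pi> / \<theta> ^ Suc l"
      using torsion_arg_split[OF M(1), of l] by (simp add: algebra_simps del: power_Suc)
    then have "carlitz_exp q \<theta> (\<pi> * torsion_arg (l + M) M) =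
        carlitz_exp q \<theta> (\<pi> * torsion_arg l M) - w l"
      by (simp only: carlitz_exp_diff carlitz_exp_pi_div)
    with Suc show ?case
      using subfield_diff[OF F(1) _ tower_in] by (simp add: l_def ac_simps)
  qed (simp add: base[OF that])
  from this[of "j mod M" "j div M"] M(1) show ?thesis
    by (simp add: mult.commute)
qed

text \<open>
  Multiplication by \<open>\<theta>\<close> lowers the index \<open>j\<close>. At \<open>j = 0\<close> a power of \<open>\<theta>\<close> splits off, and \<open>\<pi>\<close> times it
  lies in the kernel of the exponential.
\<close>

lemma exp_theta_power_torsion_arg_in:
  fixes s :: nat
  assumes m: "0 < m" "\<not> CHAR('c) dvd m"
  defines "M \<equiv> m * CHAR('c) ^ s"
  shows "carlitz_exp q \<theta> (\<pi> * (\<theta> ^ k * torsion_arg j M)) \<in> F"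
proof (induction k arbitrary: j)
  case 0
  then show ?case
    using exp_torsion_arg_in[OF m] by (simp add: M_def)
next
  case (Suc k)
  have M: "0 < M"
    using m(1) prime_gt_0_nat[OF prime_CHAR] by (simp add: M_def)
  have shift: "\<theta> ^ Suc k * torsion_arg (Suc i) M = \<theta> ^ k * torsion_arg i M" for i
    by (simp add: torsion_arg_def)
  show ?case
  proof (cases j)
    case 0
    have "\<theta> ^ Suc k * torsion_arg 0 M = \<theta> ^ k + \<theta> ^ k * torsion_arg (M - 1) M"
      using torsion_arg_split[OF M, of 0] shift[of "M - 1"] M by (simp add: distrib_left)
    then have "carlitz_exp q \<theta> (\<pi> * (\<theta> ^ Suc k * torsion_arg 0 M)) =
        carlitz_exp q \<theta> (\<pi> * (\<theta> ^ k * torsion_arg (M - 1) M))"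
      by (simp only: distrib_left carlitz_exp_add carlitz_exp_pi_mult add_0_left)
    then show ?thesis
      using Suc[of "M - 1"] by (simp only: 0)
  next
    case (Suc i)
    then show ?thesis
      using Suc.IH[of i] by (simp only: shift)
  qed
qed

lemma exp_poly_torsion_arg_in:
  fixes s :: nat
  assumes m: "0 < m" "\<not> CHAR('c) dvd m"
  defines "M \<equiv> m * CHAR('c) ^ s"
  shows "carlitz_exp q \<theta> (\<pi> * (\<theta> ^ k * ev f \<theta> * torsion_arg j M)) \<in> F"
proof (induction f arbitrary: k)
  case 0
  then show ?case
    using subfield_0[OF F(1)] by (simp add: carlitz_exp_0)
next
  case (pCons a f)
  have "\<pi> * (\<theta> ^ k * ev (pCons a f) \<theta> * torsion_arg j M) =
      \<kappa> a * (\<pi> * (\<theta> ^ k * torsion_arg j M)) + \<pi> * (\<theta> ^ Suc k * ev f \<theta> * torsion_arg j M)"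
    by (simp add: algebra_simps)
  then have "carlitz_exp q \<theta> (\<pi> * (\<theta> ^ k * ev (pCons a f) \<theta> * torsion_arg j M)) =
      \<kappa> a * carlitz_exp q \<theta> (\<pi> * (\<theta> ^ k * torsion_arg j M)) +
      carlitz_exp q \<theta> (\<pi> * (\<theta> ^ Suc k * ev f \<theta> * torsion_arg j M))"
    by (simp only: carlitz_exp_add carlitz_exp_scale[OF \<kappa>_power_q])
  moreover have "\<kappa> a \<in> F"
    using F(2) algebraic_range_\<kappa> by auto
  ultimately show ?case
    using exp_theta_power_torsion_arg_in[OF m, of k j s] pCons.IH[of "Suc k"] F(1)
    by (simp only: M_def subfield_add subfield_mult)
qed

text \<open>
  A denominator \<open>g\<close> divides some \<open>\<theta> ^ n * (\<theta> ^ M - 1)\<close>, and \<open>1 / (\<theta> ^ n * (\<theta> ^ M - 1))\<close> is one of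
  the \<open>torsion_arg j M\<close>.
\<close>

lemma exp_rational_in:
  assumes "\<rho> \<in> is_subfield hull (insert \<theta> (range \<kappa>))"
  shows "carlitz_exp q \<theta> (\<pi> * \<rho>) \<in> F"
proof -
  obtain f g where \<rho>: "ev g \<theta> \<noteq> 0" "\<rho> = ev f \<theta> / ev g \<theta>"
    using rational_functions_quotients[OF assms] .
  then have "g \<noteq> 0"
    by auto
  then obtain n M where M: "0 < M" "g dvd Polynomial.monom 1 n * (Polynomial.monom 1 M - 1)"
    using dvd_monom_minus_1 by blast
  then obtain h where "Polynomial.monom 1 n * (Polynomial.monom 1 M - 1) = g * h"
    by (elim dvdE)
  from arg_cong[OF this, of "\<lambda>f. ev f \<theta>"]
  have h: "\<theta> ^ n * (\<theta> ^ M - 1) = ev g \<theta> * ev h \<theta>"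
    by simp
  have "\<theta> ^ n * (\<theta> ^ M - 1) \<noteq> 0"
    using theta_power_neq_1[OF M(1)] by simp
  with h \<rho> have "\<rho> = ev (f * h) \<theta> / (\<theta> ^ n * (\<theta> ^ M - 1))"
    by auto
  also have "\<dots> = \<theta> ^ 0 * ev (f * h) \<theta> * torsion_arg (n + M - 1) M"
  proof -
    have "Suc (n + M - 1) = n + M"
      using M(1) by simp
    moreover have "\<theta> ^ (n + M) * (1 - 1 / \<theta> ^ M) = \<theta> ^ n * (\<theta> ^ M - 1)"
      by (simp add: power_add right_diff_distrib)
    ultimately have "torsion_arg (n + M - 1) M = 1 / (\<theta> ^ n * (\<theta> ^ M - 1))"
      by (simp only: torsion_arg_def)
    then show ?thesis
      by simp
  qed
  finally have \<rho>': "\<rho> = \<theta> ^ 0 * ev (f * h) \<theta> * torsion_arg (n + M - 1) M" .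
  have "M \<noteq> 0" "\<not> is_unit CHAR('c)"
    using M(1) prime_CHAR not_prime_unit by auto
  then obtain m where m: "M = CHAR('c) ^ multiplicity CHAR('c) M * m" "\<not> CHAR('c) dvd m"
    by (rule multiplicity_decompose')
  then have "0 < m"
    using M(1) by (cases m) auto
  from exp_poly_torsion_arg_in[OF this m(2), of 0 "f * h" "n + M - 1" "multiplicity CHAR('c) M"]
  show ?thesis
    using m(1) by (simp add: \<rho>' mult.commute[of m])
qed

end

end

theorem theorem1:
  fixes \<iota> :: "'a::{field,finite} fls alg_closure \<Rightarrow> 'c::{field,complete_space}"
    and q :: nat and \<theta> r \<pi> :: 'c and E :: "'c set"
  assumes "carlitz_completion \<iota>"
    and "q = CARD('a)"
    and "\<theta> = theta \<iota>"
    and "r ^ (q - 1) = - \<theta>"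
    and "\<pi> = carlitz_pi q \<theta> r"
    and "E = is_subfield hull
           (const_field_alg \<iota> \<union> {carlitz_exp q \<theta> (\<pi> * \<rho>) |\<rho>. \<rho> \<in> rational_functions \<iota>})"
  shows "E = is_subfield hull
           (const_field_alg \<iota> \<union>
            {fps_value (divided_deriv n (anderson_thakur_fps q \<theta> r)) \<zeta> |\<zeta> n.
               \<zeta> \<in> const_field_alg \<iota>})"
proof -
  define N where "N x = dist x 0" for x :: 'c
  define \<kappa> :: "'a \<Rightarrow> 'c" where "\<kappa> c = \<iota> (to_ac (fls_const c))" for c
  note \<iota> = assms(1)[unfolded carlitz_completion_def]
  interpret \<iota>: field_embedding \<iota>
    by unfold_locales (use \<iota> in auto)
  interpret \<kappa>: field_embedding \<kappa>
    by unfold_locales (simp_all add: \<kappa>_def flip: fls_plus_const fls_const_mult_const)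
  interpret ultrametric_field N
    by unfold_locales (use \<iota> in \<open>simp_all add: N_def\<close>)
  have "card {0, 1 :: 'a} \<le> CARD('a)"
    by (intro card_mono) auto
  then have "2 \<le> q"
    by (simp add: assms(2))
  interpret carlitz_over_finite_field N q \<theta> r \<kappa>
  proof unfold_locales
    show "2 \<le> q" by fact
    show "(x + y) ^ q = x ^ q + y ^ q" for x y :: 'c
      unfolding assms(2) by (rule power_card_add[OF \<kappa>.CHAR_eq])
    have "dist (\<iota> (to_ac f)) 0 = real CARD('a) powi (- fls_subdegree f)" if "f \<noteq> 0" for f
      using \<iota> that by blast
    from this[of fls_X_inv] show "N \<theta> = real q"
      by (simp add: N_def assms(2,3) theta_def fls_X_inv_subdegree)
    show "r ^ (q - 1) = - \<theta>" "q = CARD('a)" by fact+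
    fix m :: nat
    assume m: "0 < m" "of_nat m \<noteq> (0 :: 'c)"
    have "of_nat m \<noteq> (0 :: 'a fls alg_closure)"
      using m(2) \<iota>.\<kappa>_eq_0_iff[of "of_nat m"] by simp
    then have "m = card (\<iota> ` {z. z ^ m = 1})"
      using card_image[OF inj_on_subset[OF \<iota>.inj_\<kappa>], of "{z. z ^ m = 1}"]
        card_roots_of_unity[OF m(1), where ?'b = "'a fls alg_closure"] by simp
    also have "\<dots> \<le> card {z :: 'c. z ^ m = 1}"
      by (intro card_mono finite_roots_of_unity m) (auto simp flip: \<iota>.\<kappa>_power)
    finally show "card {z :: 'c. z ^ m = 1} = m"
      using card_roots_of_unity_le[OF m(1), where ?'b = 'c] by simp
  qed
  have const: "const_field_alg \<iota> = {x. algebraic_over (range \<kappa>) x}"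
    unfolding const_field_alg_def const_field_def \<kappa>_def ..
  have rational: "rational_functions \<iota> = is_subfield hull (insert \<theta> (range \<kappa>))"
    unfolding rational_functions_def const_field_def \<kappa>_def assms(3) ..
  define E' where "E' = is_subfield hull (const_field_alg \<iota> \<union>
      {fps_value (divided_deriv n (anderson_thakur_fps q \<theta> r)) \<zeta> |\<zeta> n. \<zeta> \<in> const_field_alg \<iota>})"
  have E_gens: "const_field_alg \<iota> \<subseteq> E" "\<rho> \<in> rational_functions \<iota> \<Longrightarrow> carlitz_exp q \<theta> (\<pi> * \<rho>) \<in> E" for \<rho>
    unfolding assms(6) by (auto intro: hull_inc)
  have E'_gens: "const_field_alg \<iota> \<subseteq> E'"
    "\<zeta> \<in> const_field_alg \<iota> \<Longrightarrow> fps_value (divided_deriv n (anderson_thakur_fps q \<theta> r)) \<zeta> \<in> E'" for n \<zeta>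
    unfolding E'_def by (auto intro: hull_inc)
  have subfields: "is_subfield E" "is_subfield E'"
    unfolding E'_def assms(6) by (rule is_subfield_hull)+
  have "E' \<subseteq> E"
    unfolding E'_def
  proof (rule hull_minimal)
    have "\<theta> \<in> rational_functions \<iota>" "is_subfield (rational_functions \<iota>)"
      unfolding rational by (simp_all add: hull_inc is_subfield_hull)
    then have "fps_value (divided_deriv n (anderson_thakur_fps q \<theta> r)) \<zeta> \<in> E"
      if "\<zeta> \<in> const_field_alg \<iota>" for n \<zeta>
      using at_value_in_subfield[of E "rational_functions \<iota>" \<zeta> n] that subfields E_gens
      by (simp add: const assms(5))
    then show "const_field_alg \<iota> \<union>
        {fps_value (divided_deriv n (anderson_thakur_fps q \<theta> r)) \<zeta> |\<zeta> n. \<zeta> \<in> const_field_alg \<iota>} \<subseteq> E"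
      using E_gens(1) by auto
  qed fact
  moreover have "E \<subseteq> E'"
    unfolding assms(6)
  proof (rule hull_minimal)
    have "carlitz_exp q \<theta> (\<pi> * \<rho>) \<in> E'" if "\<rho> \<in> rational_functions \<iota>" for \<rho>
      using exp_rational_in[of E' \<rho>] that subfields E'_gens by (simp add: const rational assms(5))
    then show "const_field_alg \<iota> \<union> {carlitz_exp q \<theta> (\<pi> * \<rho>) |\<rho>. \<rho> \<in> rational_functions \<iota>} \<subseteq> E'"
      using E'_gens(1) by auto
  qed fact
  ultimately show ?thesis
    by (simp add: E'_def)
qed

end
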